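(* Let $(X,\mathcal{B}_X,\mu,T)$ be a $\mathbb{Z}^2$-measure preserving dynamical system, let $\vec{v}=(1,\beta)\in\mathbb{R}^2$ be a direction vector with $\beta$ irrational, and let $b\in(0,\infty)$. Then $WM^{\mu,\vec{v}}(X)$ is equal to the set of all $f\in L^2(X,\mathcal{B}_X,\mu)$ such that for any $g\in L^2(X,\mathcal{B}_X,\mu)$, $$\lim_{k\to\infty}\frac{1}{\#(\Lambda_k^{\vec{v}}(b))}\sum_{(m,n)\in\Lambda_k^{\vec{v}}(b)}\left|\langle U_T^{(m,n)}f,g\rangle\right|=0.$$
   Context: A $\mathbb{Z}^2$-measure preserving dynamical system $(X,\mathcal{B}_X,\mu,T)$ consists of a compact metric space $X$, its Borel $\sigma$-algebra $\mathcal{B}_X$, a group homomorphism $(m,n)\mapsto T^{(m,n)}$ from the additive group $\mathbb{Z}^2$ to the group of homeomorphisms of $X$, and a Borel probability measure $\mu$ invariant under every $T^{(m,n)}$. For $f\in L^2(X,\mathcal{B}_X,\mu)$ (complex-valued), $U_T^{(m,n)}f=f\circ T^{(m,n)}$, and $\langle f,g\rangle=\int_X f\overline{g}\,d\mu$; $1_B$ is the indicator function of $B$. For $\vec{v}=(1,\beta)$ and $b\in(0,\infty)$, $\Lambda^{\vec{v}}(b)=\{(m,n)\in\mathbb{Z}^2:\beta m-b\le n\le\beta m+b\}$, and for $k\in\mathbb{N}$, $\Lambda_k^{\vec{v}}(b)=\Lambda^{\vec{v}}(b)\cap([0,k-1]\times\mathbb{Z})$. The directional Kronecker algebra $\mathcal{K}_\mu^{\vec{v}}$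 is the $\sigma$-algebra of all $B\in\mathcal{B}_X$ such that the closure of $\{U_T^{(m,n)}1_B:(m,n)\in\Lambda^{\vec{v}}(b)\}$ is compact in $L^2(X,\mathcal{B}_X,\mu)$; it does not depend on the choice of $b\in(0,\infty)$. A function $f\in L^2(X,\mathcal{B}_X,\mu)$ is $\vec{v}$-weakly mixing if $\mathbb{E}(f|\mathcal{K}_\mu^{\vec{v}})(x)=0$ for $\mu$-a.e. $x\in X$, and $WM^{\mu,\vec{v}}(X)$ denotes the set of all $\vec{v}$-weakly mixing functions. *)

theory Defs
  imports "HOL-Probability.Probability"
begin

locale z2_mps = prob_space M
  for M :: "'a::metric_space measure" and T :: "int \<times> int \<Rightarrow> 'a \<Rightarrow> 'a" +
  assumes compact_space: "compact (UNIV :: 'a set)"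
    and sets_borel: "sets M = sets borel"
    and homeo: "\<exists>S. homeomorphism UNIV UNIV (T v) S"
    and hom: "T (u + v) = T u \<circ> T v"
    and invariant: "distr M M (T v) = M"

definition koopman :: "(int \<times> int \<Rightarrow> 'a \<Rightarrow> 'a) \<Rightarrow> int \<times> int \<Rightarrow> ('a \<Rightarrow> complex) \<Rightarrow> 'a \<Rightarrow> complex" where
  "koopman T v f = f \<circ> T v"


subsection \<open>Square-integrable functions\<close>

text \<open>Elements of \<open>L2_fun\<close> are functions, not classes modulo null sets; the classes form
  \<open>L2_space\<close>, which carries the genuine metric \<open>L2_dist\<close> needed for compactness.\<close>

definition L2_fun :: "'a measure \<Rightarrow> ('a \<Rightarrow> complex) set" where
  "L2_fun M = {f \<in> borel_measurable M. integrable M (\<lambda>x. (cmod (f x))\<^sup>2)}"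

definition L2_inner :: "'a measure \<Rightarrow> ('a \<Rightarrow> complex) \<Rightarrow> ('a \<Rightarrow> complex) \<Rightarrow> complex" where
  "L2_inner M f g = (\<integral>x. f x * cnj (g x) \<partial>M)"

definition L2_norm :: "'a measure \<Rightarrow> ('a \<Rightarrow> complex) \<Rightarrow> real" where
  "L2_norm M f = sqrt (\<integral>x. (cmod (f x))\<^sup>2 \<partial>M)"

definition L2_class :: "'a measure \<Rightarrow> ('a \<Rightarrow> complex) \<Rightarrow> ('a \<Rightarrow> complex) set" where
  "L2_class M f = {g \<in> L2_fun M. AE x in M. g x = f x}"

definition L2_space :: "'a measure \<Rightarrow> ('a \<Rightarrow> complex) set set" where
  "L2_space M = L2_class M ` L2_fun M"

definition L2_dist :: "'a measure \<Rightarrow> ('a \<Rightarrow> complex) set \<Rightarrow> ('a \<Rightarrow> complex) set \<Rightarrow> real" where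
  "L2_dist M P Q = L2_norm M (\<lambda>x. (SOME f. f \<in> P) x - (SOME g. g \<in> Q) x)"

abbreviation L2_topology :: "'a measure \<Rightarrow> ('a \<Rightarrow> complex) set topology" where
  "L2_topology M \<equiv> Metric_space.mtopology (L2_space M) (L2_dist M)"

lemma L2_fun_diff:
  assumes "f \<in> L2_fun M" "g \<in> L2_fun M"
  shows "(\<lambda>x. f x - g x) \<in> L2_fun M"
proof -
  have [measurable]: "f \<in> borel_measurable M" "g \<in> borel_measurable M"
    and i: "integrable M (\<lambda>x. (cmod (f x))\<^sup>2)" "integrable M (\<lambda>x. (cmod (g x))\<^sup>2)"
    using assms by (auto simp: L2_fun_def)
  have bound: "(cmod (a - b))\<^sup>2 \<le> 2 * (cmod a)\<^sup>2 + 2 * (cmod b)\<^sup>2" for a b :: complex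
  proof -
    have "(cmod (a - b))\<^sup>2 \<le> (cmod a + cmod b)\<^sup>2"
      by (intro power_mono norm_triangle_ineq4) simp
    also have "\<dots> \<le> 2 * (cmod a)\<^sup>2 + 2 * (cmod b)\<^sup>2"
      using sum_squares_bound[of "cmod a" "cmod b"] by (simp add: power2_sum)
    finally show ?thesis .
  qed
  have "integrable M (\<lambda>x. (cmod (f x - g x))\<^sup>2)"
    by (rule Bochner_Integration.integrable_bound[where f="\<lambda>x. 2 * (cmod (f x))\<^sup>2 + 2 * (cmod (g x))\<^sup>2"])
       (use i bound in \<open>auto intro!: Bochner_Integration.integrable_add\<close>)
  then show ?thesis by (simp add: L2_fun_def)
qed

lemma L2_class_some:
  assumes "f \<in> L2_fun M"
  shows "(SOME h. h \<in> L2_class M f) \<in> L2_fun M" "AE x in M. (SOME h. h \<in> L2_class M f) x = f x"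
proof -
  have "f \<in> L2_class M f" using assms by (simp add: L2_class_def)
  then have "(SOME h. h \<in> L2_class M f) \<in> L2_class M f" by (rule someI[where P="\<lambda>h. h \<in> L2_class M f"])
  then show "(SOME h. h \<in> L2_class M f) \<in> L2_fun M"
    "AE x in M. (SOME h. h \<in> L2_class M f) x = f x" by (auto simp: L2_class_def)
qed

lemma L2_dist_class:
  assumes f: "f \<in> L2_fun M" and g: "g \<in> L2_fun M"
  shows "L2_dist M (L2_class M f) (L2_class M g) = L2_norm M (\<lambda>x. f x - g x)"
proof -
  define f' g' where "f' = (SOME h. h \<in> L2_class M f)" and "g' = (SOME h. h \<in> L2_class M g)"
  have fg': "f' \<in> L2_fun M" "AE x in M. f' x = f x" "g' \<in> L2_fun M" "AE x in M. g' x = g x"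
    using L2_class_some[OF f] L2_class_some[OF g] by (auto simp: f'_def g'_def)
  have [measurable]: "f \<in> borel_measurable M" "g \<in> borel_measurable M"
      "f' \<in> borel_measurable M" "g' \<in> borel_measurable M"
    using f g fg' by (auto simp: L2_fun_def)
  have "(\<integral>x. (cmod (f' x - g' x))\<^sup>2 \<partial>M) = (\<integral>x. (cmod (f x - g x))\<^sup>2 \<partial>M)"
    by (rule integral_cong_AE) (use fg' in auto)
  then show ?thesis unfolding L2_dist_def L2_norm_def f'_def g'_def by simp
qed

lemma L2_norm_triangle:
  assumes f: "f \<in> L2_fun M" and g: "g \<in> L2_fun M"
  shows "L2_norm M (\<lambda>x. f x - g x) \<le> L2_norm M f + L2_norm M g"
proof -
  define A B where "A = (\<integral>x. (cmod (f x))\<^sup>2 \<partial>M)" and "B = (\<integral>x. (cmod (g x))\<^sup>2 \<partial>M)"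
  have [measurable]: "f \<in> borel_measurable M" "g \<in> borel_measurable M"
    and i: "integrable M (\<lambda>x. (cmod (f x))\<^sup>2)" "integrable M (\<lambda>x. (cmod (g x))\<^sup>2)"
    using assms by (auto simp: L2_fun_def)
  have d: "integrable M (\<lambda>x. (cmod (f x - g x))\<^sup>2)"
    using L2_fun_diff[OF f g] by (simp add: L2_fun_def)
  have AB: "A \<ge> 0" "B \<ge> 0" by (auto simp: A_def B_def)
  have key: "(\<integral>x. (cmod (f x - g x))\<^sup>2 \<partial>M) \<le> (1 + t) * A + (1 + 1/t) * B" if t: "t > 0" for t :: real
  proof -
    have p: "(cmod (a - b))\<^sup>2 \<le> (1 + t) * (cmod a)\<^sup>2 + (1 + 1/t) * (cmod b)\<^sup>2" for a b :: complex
    proof -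
      have "0 \<le> (sqrt t * cmod a - cmod b / sqrt t)\<^sup>2" by simp
      also have "\<dots> = t * (cmod a)\<^sup>2 + (1/t) * (cmod b)\<^sup>2 - 2 * cmod a * cmod b"
        using t by (simp add: power2_diff power_mult_distrib power_divide)
      finally have "2 * cmod a * cmod b \<le> t * (cmod a)\<^sup>2 + (1/t) * (cmod b)\<^sup>2" by simp
      moreover have "(cmod (a - b))\<^sup>2 \<le> (cmod a + cmod b)\<^sup>2"
        by (intro power_mono norm_triangle_ineq4) simp
      ultimately show ?thesis by (simp add: power2_sum algebra_simps)
    qed
    have "(\<integral>x. (cmod (f x - g x))\<^sup>2 \<partial>M)
        \<le> (\<integral>x. (1 + t) * (cmod (f x))\<^sup>2 + (1 + 1/t) * (cmod (g x))\<^sup>2 \<partial>M)"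
      by (rule integral_mono) (use i d p in auto)
    also have "\<dots> = (1 + t) * A + (1 + 1/t) * B"
      using i by (simp add: A_def B_def)
    finally show ?thesis .
  qed
  have "sqrt (\<integral>x. (cmod (f x - g x))\<^sup>2 \<partial>M) \<le> sqrt A + sqrt B"
  proof (rule field_le_epsilon)
    fix e :: real assume e: "e > 0"
    define a b where "a = sqrt A + e/2" and "b = sqrt B + e/2"
    have ab: "a > 0" "b > 0" using AB e by (auto simp: a_def b_def add_nonneg_pos)
    have le: "A \<le> a\<^sup>2" "B \<le> b\<^sup>2"
      using AB e power_mono[of "sqrt A" a 2] power_mono[of "sqrt B" b 2] by (auto simp: a_def b_def)
    have "(\<integral>x. (cmod (f x - g x))\<^sup>2 \<partial>M) \<le> (1 + b/a) * A + (1 + 1/(b/a)) * B"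
      by (rule key) (use ab in simp)
    also have "\<dots> \<le> (1 + b/a) * a\<^sup>2 + (1 + 1/(b/a)) * b\<^sup>2"
      using ab le by (intro add_mono mult_left_mono) auto
    also have "\<dots> = (a + b)\<^sup>2" using ab by (simp add: field_simps power2_eq_square)
    finally have "sqrt (\<integral>x. (cmod (f x - g x))\<^sup>2 \<partial>M) \<le> a + b"
      using ab by (intro real_le_lsqrt) auto
    then show "sqrt (\<integral>x. (cmod (f x - g x))\<^sup>2 \<partial>M) \<le> sqrt A + sqrt B + e"
      by (simp add: a_def b_def)
  qed
  then show ?thesis by (simp add: L2_norm_def A_def B_def)
qed

lemma L2_Metric_space: "Metric_space (L2_space M) (L2_dist M)"
proof
  show "0 \<le> L2_dist M P Q" for P Q
    by (simp add: L2_dist_def L2_norm_def)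
  show "L2_dist M P Q = L2_dist M Q P" for P Q
    by (simp add: L2_dist_def L2_norm_def norm_minus_commute)
  show "L2_dist M P Q = 0 \<longleftrightarrow> P = Q" if PQ: "P \<in> L2_space M" "Q \<in> L2_space M" for P Q
  proof -
    obtain f g where f: "f \<in> L2_fun M" "P = L2_class M f" and g: "g \<in> L2_fun M" "Q = L2_class M g"
      using PQ by (auto simp: L2_space_def)
    have "integrable M (\<lambda>x. (cmod (f x - g x))\<^sup>2)"
      using L2_fun_diff[OF f(1) g(1)] by (simp add: L2_fun_def)
    then have "L2_dist M P Q = 0 \<longleftrightarrow> (AE x in M. f x = g x)"
      by (simp add: f g L2_dist_class L2_norm_def integral_nonneg_eq_0_iff_AE)
    also have "\<dots> \<longleftrightarrow> P = Q"
    proof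
      assume ae: "AE x in M. f x = g x"
      have "(AE x in M. h x = f x) \<longleftrightarrow> (AE x in M. h x = g x)" for h
        using ae by (auto elim: eventually_elim2)
      then show "P = Q" by (simp add: f g L2_class_def)
    next
      assume "P = Q"
      then have "f \<in> L2_class M g" using f g by (auto simp: L2_class_def)
      then show "AE x in M. f x = g x" by (simp add: L2_class_def)
    qed
    finally show ?thesis .
  qed
  show "L2_dist M P R \<le> L2_dist M P Q + L2_dist M Q R"
    if PQR: "P \<in> L2_space M" "Q \<in> L2_space M" "R \<in> L2_space M" for P Q R
  proof -
    obtain f g h where *: "f \<in> L2_fun M" "P = L2_class M f" "g \<in> L2_fun M" "Q = L2_class M g"
        "h \<in> L2_fun M" "R = L2_class M h"
      using PQR by (auto simp: L2_space_def)
    have "L2_norm M (\<lambda>x. (f x - g x) - (h x - g x))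
        \<le> L2_norm M (\<lambda>x. f x - g x) + L2_norm M (\<lambda>x. h x - g x)"
      using * by (intro L2_norm_triangle L2_fun_diff)
    moreover have "L2_norm M (\<lambda>x. h x - g x) = L2_norm M (\<lambda>x. g x - h x)"
      by (simp add: L2_norm_def norm_minus_commute)
    ultimately show ?thesis using * by (simp add: L2_dist_class)
  qed
qed


subsection \<open>Directional Kronecker algebra and directional weak mixing\<close>

text \<open>The direction vector is \<open>(1, \<beta>)\<close> and is represented by its slope \<open>\<beta>\<close>.\<close>

definition strip :: "real \<Rightarrow> real \<Rightarrow> (int \<times> int) set" where
  "strip \<beta> b = {(m, n). \<beta> * of_int m - b \<le> of_int n \<and> of_int n \<le> \<beta> * of_int m + b}"

definition strip_upto :: "real \<Rightarrow> real \<Rightarrow> nat \<Rightarrow> (int \<times> int) set" where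
  "strip_upto \<beta> b k = strip \<beta> b \<inter> ({0..int k - 1} \<times> UNIV)"

lemma finite_strip_upto: "finite (strip_upto \<beta> b k)"
proof -
  have "strip_upto \<beta> b k \<subseteq>
      (\<Union>m\<in>{0..int k - 1}. {m} \<times> {\<lceil>\<beta> * of_int m - b\<rceil>..\<lfloor>\<beta> * of_int m + b\<rfloor>})"
    by (auto simp: strip_upto_def strip_def ceiling_le_iff le_floor_iff)
  then show ?thesis by (rule finite_subset) auto
qed

definition kronecker_sets ::
  "'a measure \<Rightarrow> (int \<times> int \<Rightarrow> 'a \<Rightarrow> 'a) \<Rightarrow> real \<Rightarrow> real \<Rightarrow> 'a set set" where
  "kronecker_sets M T \<beta> b = {B \<in> sets M.
     compactin (L2_topology M)
       (L2_topology M closure_of ((\<lambda>v. L2_class M (koopman T v (indicator B))) ` strip \<beta> b))}"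

text \<open>The sets in \<open>kronecker_sets\<close> already form a \<open>\<sigma>\<close>-algebra, independent of \<open>b > 0\<close>;
  \<open>sigma\<close> only packages them as the measure-space object that \<open>real_cond_exp\<close> expects.\<close>

definition kronecker_algebra ::
  "'a measure \<Rightarrow> (int \<times> int \<Rightarrow> 'a \<Rightarrow> 'a) \<Rightarrow> real \<Rightarrow> real \<Rightarrow> 'a measure" where
  "kronecker_algebra M T \<beta> b = sigma (space M) (kronecker_sets M T \<beta> b)"

text \<open>The library's conditional expectation is real-valued, so it is extended componentwise.\<close>

definition complex_cond_exp :: "'a measure \<Rightarrow> 'a measure \<Rightarrow> ('a \<Rightarrow> complex) \<Rightarrow> 'a \<Rightarrow> complex" where
  "complex_cond_exp M F f x =
     Complex (real_cond_exp M F (\<lambda>y. Re (f y)) x) (real_cond_exp M F (\<lambda>y. Im (f y)) x)"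

definition WM ::
  "'a measure \<Rightarrow> (int \<times> int \<Rightarrow> 'a \<Rightarrow> 'a) \<Rightarrow> real \<Rightarrow> real \<Rightarrow> ('a \<Rightarrow> complex) set" where
  "WM M T \<beta> b =
     {f \<in> L2_fun M. AE x in M. complex_cond_exp M (kronecker_algebra M T \<beta> b) f x = 0}"

lemma (in z2_mps) subalgebra_kronecker: "subalgebra M (kronecker_algebra M T \<beta> b)"
proof -
  have "kronecker_sets M T \<beta> b \<subseteq> sets M" by (auto simp: kronecker_sets_def)
  moreover from this have "kronecker_sets M T \<beta> b \<subseteq> Pow (space M)"
    using sets.space_closed by blast
  ultimately show ?thesis
    by (simp add: subalgebra_def kronecker_algebra_def space_measure_of_conv sets.sigma_sets_subset)
qed

end

theory Submission
  imports Defs "HOL-Analysis.Kronecker_Approximation_Theorem"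
begin

text \<open>Write \<open>f\<^sub>u\<close> for \<open>koopman T u f\<close>. A function orthogonal to the directional Kronecker algebra is
  orthogonal to every \<open>h\<close> whose orbit along the strip is totally bounded, because the superlevel
  sets of the real and imaginary parts of \<open>h\<close> lie in that algebra. To produce such \<open>h\<close>, consider the
  finite-rank operators \<open>A\<^sub>w = \<Sum>\<^sub>u w\<^sub>u f\<^sub>u \<otimes> f\<^sub>u\<^sup>*\<close>, where \<open>w\<close> is a probability weight supported in a
  strip of width \<open>t\<close>, with squared Hilbert--Schmidt norm
  \<open>\<Sum>\<^sub>u\<^sub>,\<^sub>v w\<^sub>u w\<^sub>v \<bar>\<langle>f\<^sub>u, f\<^sub>v\<rangle>\<bar>\<^sup>2\<close>. Minimizing this norm at a suitable \<open>t\<close> gives a Cauchy sequence of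
  operators that is almost invariant under small shifts; applied to any \<open>\<phi>\<close> its limit is almost
  periodic. Orthogonality then forces the minimum to be \<open>0\<close>, and a weight with small norm bounds the
  averages of \<open>\<bar>\<langle>f\<^sub>v, g\<rangle>\<bar>\<^sup>2\<close> along the strip uniformly in all translates. Conversely, if the
  averages vanish, then \<open>\<langle>f, 1\<^sub>B\<rangle> = \<langle>f\<^sub>v, koopman T v 1\<^sub>B\<rangle>\<close> is approximated by the coefficients of
  \<open>f\<^sub>v\<close> against finitely many functions.\<close>

subsection \<open>The space of square-integrable functions\<close>

text \<open>A strip is not a subgroup of the lattice, so invariance under a group action cannot be
  exploited: a shift moves a weight out of its strip into a wider one. Hence only almost invariance
  under small shifts is available, and that only at a width where the minimum varies continuously.
  The numbers attached to pairs \<open>u\<close>, \<open>v\<close> are the Hilbert-Schmidt inner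
  products of the rank-one operators, so the minimization is von Neumann's argument for the mean
  ergodic theorem (nearly minimal norm in a convex set) carried out in the Hilbert space of these
  operators. Irrationality of the slope enters through a single fact: finitely many translates of an
  arbitrarily thin strip cover a wide one. It turns almost invariance under thin shifts into
  compactness of a whole orbit, makes the width of the strip irrelevant, and gives the strip
  positive density along the first coordinate.\<close>

lemma L2_funI:
  "f \<in> borel_measurable M \<Longrightarrow> integrable M (\<lambda>x. (cmod (f x))\<^sup>2) \<Longrightarrow> f \<in> L2_fun M"
  by (simp add: L2_fun_def)

lemma L2_fun_measurable: "f \<in> L2_fun M \<Longrightarrow> f \<in> borel_measurable M"
  by (simp add: L2_fun_def)

lemma L2_fun_integrable: "f \<in> L2_fun M \<Longrightarrow> integrable M (\<lambda>x. (cmod (f x))\<^sup>2)"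
  by (simp add: L2_fun_def)

lemma L2_fun_zero: "(\<lambda>x. 0) \<in> L2_fun M"
  by (simp add: L2_fun_def)

lemma L2_fun_scale:
  assumes "f \<in> L2_fun M"
  shows "(\<lambda>x. a * f x) \<in> L2_fun M"
  using assms by (auto simp: L2_fun_def norm_mult power_mult_distrib)

lemma L2_fun_add:
  assumes "f \<in> L2_fun M" "g \<in> L2_fun M"
  shows "(\<lambda>x. f x + g x) \<in> L2_fun M"
  using L2_fun_diff[OF assms(1) L2_fun_scale[OF assms(2), of "-1"]] by simp

lemma L2_fun_sum:
  assumes "\<And>i. i \<in> S \<Longrightarrow> f i \<in> L2_fun M"
  shows "(\<lambda>x. \<Sum>i\<in>S. f i x) \<in> L2_fun M"
  using assms by (induction S rule: infinite_finite_induct) (auto intro: L2_fun_zero L2_fun_add)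

lemma L2_fun_dominated:
  assumes [measurable]: "g \<in> borel_measurable M" and "f \<in> L2_fun M" "\<And>x. cmod (g x) \<le> cmod (f x)"
  shows "g \<in> L2_fun M"
proof (rule L2_funI)
  show "integrable M (\<lambda>x. (cmod (g x))\<^sup>2)"
    by (rule Bochner_Integration.integrable_bound[OF L2_fun_integrable[OF assms(2)]])
       (auto intro!: power_mono assms(3))
qed fact

lemma (in finite_measure) L2_fun_const: "(\<lambda>x. a) \<in> L2_fun M"
  by (simp add: L2_fun_def)

lemma (in finite_measure) L2_fun_bounded:
  assumes "f \<in> borel_measurable M" "\<And>x. cmod (f x) \<le> C"
  shows "f \<in> L2_fun M"
proof (rule L2_fun_dominated[OF assms(1) L2_fun_const])
  show "cmod (f x) \<le> cmod (of_real C)" for x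
    using assms(2)[of x] by (simp add: order_trans[OF _ abs_ge_self])
qed

lemma (in finite_measure) L2_fun_indicator: "A \<in> sets M \<Longrightarrow> indicator A \<in> L2_fun M"
  by (rule L2_fun_bounded[where C = 1]) (auto simp: indicator_def)

lemma L2_norm_nonneg [simp]: "0 \<le> L2_norm M f"
  by (simp add: L2_norm_def)

lemma L2_norm_power2: "(L2_norm M f)\<^sup>2 = (\<integral>x. (cmod (f x))\<^sup>2 \<partial>M)"
  by (simp add: L2_norm_def)

lemma L2_norm_scale: "L2_norm M (\<lambda>x. a * f x) = cmod a * L2_norm M f"
  by (simp add: L2_norm_def norm_mult power_mult_distrib real_sqrt_mult)

lemma L2_norm_minus_commute: "L2_norm M (\<lambda>x. f x - g x) = L2_norm M (\<lambda>x. g x - f x)"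
  by (simp add: L2_norm_def norm_minus_commute)

lemma L2_norm_zero [simp]: "L2_norm M (\<lambda>x. 0) = 0"
  by (simp add: L2_norm_def)

lemma L2_norm_add_le:
  assumes "f \<in> L2_fun M" "g \<in> L2_fun M"
  shows "L2_norm M (\<lambda>x. f x + g x) \<le> L2_norm M f + L2_norm M g"
  using L2_norm_triangle[OF assms(1) L2_fun_scale[OF assms(2), of "-1"]] L2_norm_scale[of M "-1" g]
  by simp

lemma L2_norm_diff_triangle:
  assumes "f \<in> L2_fun M" "g \<in> L2_fun M" "h \<in> L2_fun M"
  shows "L2_norm M (\<lambda>x. f x - h x) \<le> L2_norm M (\<lambda>x. f x - g x) + L2_norm M (\<lambda>x. g x - h x)"
  using L2_norm_add_le[OF L2_fun_diff[OF assms(1,2)] L2_fun_diff[OF assms(2,3)]] by simp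

lemma borel_measurable_cnj [measurable (raw)]:
  "f \<in> borel_measurable M \<Longrightarrow> (\<lambda>x. cnj (f x)) \<in> borel_measurable M"
  by (rule borel_measurable_continuous_on[of cnj]) (auto intro: continuous_intros)

lemma L2_mult_cnj_integrable:
  assumes "f \<in> L2_fun M" "g \<in> L2_fun M"
  shows "integrable M (\<lambda>x. f x * cnj (g x))"
proof (rule Bochner_Integration.integrable_bound)
  show "integrable M (\<lambda>x. (cmod (f x))\<^sup>2 + (cmod (g x))\<^sup>2)"
    using assms by (auto simp: L2_fun_def)
  have [measurable]: "f \<in> borel_measurable M" "g \<in> borel_measurable M"
    using assms by (auto simp: L2_fun_def)
  show "(\<lambda>x. f x * cnj (g x)) \<in> borel_measurable M"
    by measurable
  have "cmod (a * cnj b) \<le> norm ((cmod a)\<^sup>2 + (cmod b)\<^sup>2)" for a b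
  proof -
    have "2 * (cmod a * cmod b) \<le> (cmod a)\<^sup>2 + (cmod b)\<^sup>2"
      using sum_squares_bound[of "cmod a" "cmod b"] by simp
    moreover have "0 \<le> cmod a * cmod b" by simp
    ultimately show ?thesis unfolding norm_mult complex_mod_cnj real_norm_def by linarith
  qed
  then show "AE x in M. cmod (f x * cnj (g x)) \<le> norm ((cmod (f x))\<^sup>2 + (cmod (g x))\<^sup>2)" by simp
qed

section \<open>The inner product and the Cauchy-Schwarz inequality\<close>

lemma L2_inner_self: "L2_inner M f f = complex_of_real ((L2_norm M f)\<^sup>2)"
proof -
  have "L2_inner M f f = (\<integral>x. complex_of_real ((cmod (f x))\<^sup>2) \<partial>M)"
    by (simp add: L2_inner_def flip: complex_norm_square)
  then show ?thesis by (simp only: integral_complex_of_real L2_norm_power2)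
qed

lemma L2_inner_commute: "L2_inner M g f = cnj (L2_inner M f g)"
  by (simp add: L2_inner_def mult.commute flip: Bochner_Integration.integral_cnj)

lemma L2_inner_scale_left: "L2_inner M (\<lambda>x. a * f x) g = a * L2_inner M f g"
  by (simp add: L2_inner_def mult.assoc)

lemma L2_inner_diff_left:
  assumes "f \<in> L2_fun M" "g \<in> L2_fun M" "h \<in> L2_fun M"
  shows "L2_inner M (\<lambda>x. f x - g x) h = L2_inner M f h - L2_inner M g h"
  using L2_mult_cnj_integrable[OF assms(1,3)] L2_mult_cnj_integrable[OF assms(2,3)]
  by (simp add: L2_inner_def left_diff_distrib)

lemma L2_inner_sum_left:
  assumes "\<And>i. i \<in> S \<Longrightarrow> f i \<in> L2_fun M" "g \<in> L2_fun M"
  shows "L2_inner M (\<lambda>x. \<Sum>i\<in>S. f i x) g = (\<Sum>i\<in>S. L2_inner M (f i) g)"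
  using L2_mult_cnj_integrable[OF assms]
  by (simp add: L2_inner_def sum_distrib_right)

lemma L2_inner_sum_scale_left:
  assumes "\<And>i. i \<in> S \<Longrightarrow> f i \<in> L2_fun M" "g \<in> L2_fun M"
  shows "L2_inner M (\<lambda>x. \<Sum>i\<in>S. a i * f i x) g = (\<Sum>i\<in>S. a i * L2_inner M (f i) g)"
  using L2_inner_sum_left[of S "\<lambda>i x. a i * f i x" M g] assms
  by (simp add: L2_fun_scale L2_inner_scale_left)

text \<open>With \<open>z\<close> the inner product, the squared norm of \<open>f - t z g\<close> is
  a polynomial of degree at most 2 in the real variable \<open>t\<close> and never negative.
  Elements are functions, so \<open>g\<close> may have norm 0 without being zero everywhere; that
  case is treated separately.\<close>

lemma L2_Cauchy_Schwarz:
  assumes f: "f \<in> L2_fun M" and g: "g \<in> L2_fun M"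
  shows "cmod (L2_inner M f g) \<le> L2_norm M f * L2_norm M g"
proof -
  define z where "z = L2_inner M f g"
  define B where "B = (L2_norm M g)\<^sup>2"
  have expand: "0 \<le> (L2_norm M f)\<^sup>2 - 2 * t * (cmod z)\<^sup>2 + t\<^sup>2 * (cmod z)\<^sup>2 * B" for t :: real
  proof -
    let ?h = "\<lambda>x. f x - (t * z) * g x"
    have h: "?h \<in> L2_fun M" and sg: "(\<lambda>x. (t * z) * g x) \<in> L2_fun M"
      using f g by (auto intro: L2_fun_diff L2_fun_scale)
    have "L2_inner M ?h ?h = L2_inner M f ?h - t * z * L2_inner M g ?h"
      using L2_inner_diff_left[OF f sg h] by (simp add: L2_inner_scale_left)
    also have "L2_inner M f ?h = cnj (L2_inner M ?h f)" by (rule L2_inner_commute)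
    also have "L2_inner M ?h f = L2_inner M f f - t * z * L2_inner M g f"
      using L2_inner_diff_left[OF f sg f] by (simp add: L2_inner_scale_left)
    also have "L2_inner M g ?h = cnj (L2_inner M ?h g)" by (rule L2_inner_commute)
    also have "L2_inner M ?h g = z - t * z * L2_inner M g g"
      using L2_inner_diff_left[OF f sg g] by (simp add: L2_inner_scale_left z_def)
    also have "L2_inner M g f = cnj z" by (simp add: z_def L2_inner_commute[of M g f])
    finally have "complex_of_real ((L2_norm M ?h)\<^sup>2)
        = (L2_norm M f)\<^sup>2 - 2 * t * (z * cnj z) + t\<^sup>2 * (z * cnj z) * B"
      by (simp add: L2_inner_self B_def algebra_simps power2_eq_square)
    also have "\<dots> = complex_of_real ((L2_norm M f)\<^sup>2 - 2 * t * (cmod z)\<^sup>2 + t\<^sup>2 * (cmod z)\<^sup>2 * B)"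
      by (simp flip: complex_norm_square)
    finally show ?thesis by (metis of_real_eq_iff zero_le_power2)
  qed
  have "(cmod z)\<^sup>2 \<le> (L2_norm M f)\<^sup>2 * B"
  proof (cases "B = 0")
    case True
    show ?thesis
    proof (rule ccontr)
      assume "\<not> ?thesis"
      then have z: "(cmod z)\<^sup>2 > 0" using True by simp
      \<comment> \<open>Here the polynomial is affine in \<open>t\<close>, and at this
        \<open>t\<close> its value is -1.\<close>
      show False
        using expand[of "((L2_norm M f)\<^sup>2 + 1) / (2 * (cmod z)\<^sup>2)"] z True by (simp add: field_simps)
    qed
  next
    case False
    then have "B > 0" by (simp add: B_def)
    \<comment> \<open>\<open>1 / B\<close> is where the quadratic is smallest.\<close>
    then show ?thesis using expand[of "1 / B"] by (simp add: field_simps power2_eq_square)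
  qed
  then have "(cmod z)\<^sup>2 \<le> (L2_norm M f * L2_norm M g)\<^sup>2"
    by (simp add: B_def power_mult_distrib)
  then show ?thesis unfolding z_def by (rule power2_le_imp_le) simp
qed

text \<open>The finite-rank operator \<open>\<Sum>c\<^sub>i p\<^sub>i \<otimes> p\<^sub>i\<^sup>*\<close> is dominated by its Hilbert--Schmidt
  norm, which is computed from the kernel \<open>\<Sum>c\<^sub>i p\<^sub>i(x) cnj (p\<^sub>i(y))\<close> by integrating one
  variable at a time.\<close>

lemma Hilbert_Schmidt_kernel:
  fixes c :: "'i \<Rightarrow> real"
  assumes p: "\<And>i. i \<in> S \<Longrightarrow> p i \<in> L2_fun M"
  defines "k \<equiv> \<lambda>x y. \<Sum>i\<in>S. (c i * cnj (p i x)) * p i y"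
  shows "has_bochner_integral M (\<lambda>x. (L2_norm M (k x))\<^sup>2)
           (\<Sum>i\<in>S. \<Sum>j\<in>S. c i * c j * (cmod (L2_inner M (p i) (p j)))\<^sup>2)"
proof -
  have k: "k x \<in> L2_fun M" for x
    unfolding k_def by (intro L2_fun_sum L2_fun_scale p)
  have inner_k: "complex_of_real ((L2_norm M (k x))\<^sup>2) =
      (\<Sum>i\<in>S. \<Sum>j\<in>S. (c i * c j * L2_inner M (p i) (p j)) * (p j x * cnj (p i x)))" for x
  proof -
    have "complex_of_real ((L2_norm M (k x))\<^sup>2) = L2_inner M (k x) (k x)"
      by (simp add: L2_inner_self)
    also have "\<dots> = (\<Sum>i\<in>S. c i * cnj (p i x) * L2_inner M (p i) (k x))"
      by (subst (1) k_def) (intro L2_inner_sum_scale_left p k)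
    also have "\<dots> = (\<Sum>i\<in>S. c i * cnj (p i x) * (\<Sum>j\<in>S. c j * p j x * L2_inner M (p i) (p j)))"
    proof (intro sum.cong refl)
      fix i assume i: "i \<in> S"
      have "L2_inner M (k x) (p i) = (\<Sum>j\<in>S. c j * cnj (p j x) * L2_inner M (p j) (p i))"
        unfolding k_def by (intro L2_inner_sum_scale_left p i)
      then have "L2_inner M (p i) (k x) = (\<Sum>j\<in>S. c j * p j x * L2_inner M (p i) (p j))"
        by (subst L2_inner_commute) (simp add: L2_inner_commute[of M _ "p i"])
      then show "c i * cnj (p i x) * L2_inner M (p i) (k x) =
          c i * cnj (p i x) * (\<Sum>j\<in>S. c j * p j x * L2_inner M (p i) (p j))" by simp
    qed
    finally show ?thesis by (simp add: sum_distrib_left mult_ac)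
  qed
  have "has_bochner_integral M (\<lambda>x. complex_of_real ((L2_norm M (k x))\<^sup>2))
     (\<Sum>i\<in>S. \<Sum>j\<in>S. (c i * c j * L2_inner M (p i) (p j)) * L2_inner M (p j) (p i))"
    unfolding inner_k
    by (intro has_bochner_integral_sum has_bochner_integral_mult_right)
       (auto simp: has_bochner_integral_iff L2_inner_def intro!: L2_mult_cnj_integrable p)
  also have "(\<Sum>i\<in>S. \<Sum>j\<in>S. (c i * c j * L2_inner M (p i) (p j)) * L2_inner M (p j) (p i)) =
     complex_of_real (\<Sum>i\<in>S. \<Sum>j\<in>S. c i * c j * (cmod (L2_inner M (p i) (p j)))\<^sup>2)"
  proof -
    have "(c i * c j * L2_inner M (p i) (p j)) * L2_inner M (p j) (p i) =
        complex_of_real (c i * c j * (cmod (L2_inner M (p i) (p j)))\<^sup>2)" for i j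
      unfolding L2_inner_commute[of M "p j" "p i"] by (simp flip: complex_norm_square add: mult.assoc)
    then show ?thesis by (simp only: of_real_sum)
  qed
  finally show ?thesis
    using has_bochner_integral_Re by fastforce
qed

text \<open>The double sum is the integral of a square, whatever the signs of \<open>c\<close>;
  signed coefficients occur later as differences of two weights.\<close>

lemma Hilbert_Schmidt_nonneg:
  fixes c :: "'i \<Rightarrow> real"
  assumes "\<And>i. i \<in> S \<Longrightarrow> p i \<in> L2_fun M"
  shows "0 \<le> (\<Sum>i\<in>S. \<Sum>j\<in>S. c i * c j * (cmod (L2_inner M (p i) (p j)))\<^sup>2)"
  using Hilbert_Schmidt_kernel[of S p M c, OF assms]
  by (auto simp: has_bochner_integral_iff dest: sym)

text \<open>At each \<open>x\<close> the function on the left is the inner product of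
  \<open>\<phi>\<close> with the row \<open>k x\<close>, so Cauchy-Schwarz in the inner variable
  followed by integration over \<open>x\<close> gives the bound.\<close>

lemma Hilbert_Schmidt_bound:
  fixes c :: "'i \<Rightarrow> real"
  assumes p: "\<And>i. i \<in> S \<Longrightarrow> p i \<in> L2_fun M" and \<phi>: "\<phi> \<in> L2_fun M"
  shows "(L2_norm M (\<lambda>x. \<Sum>i\<in>S. (c i * L2_inner M \<phi> (p i)) * p i x))\<^sup>2 \<le>
           (\<Sum>i\<in>S. \<Sum>j\<in>S. c i * c j * (cmod (L2_inner M (p i) (p j)))\<^sup>2) * (L2_norm M \<phi>)\<^sup>2"
proof -
  define k where "k x y = (\<Sum>i\<in>S. (c i * cnj (p i x)) * p i y)" for x y
  have k: "k x \<in> L2_fun M" for x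
    unfolding k_def by (intro L2_fun_sum L2_fun_scale p)
  define A where "A x = (\<Sum>i\<in>S. (c i * L2_inner M \<phi> (p i)) * p i x)" for x
  have "A x = L2_inner M \<phi> (k x)" for x
  proof -
    have "L2_inner M (k x) \<phi> = (\<Sum>i\<in>S. c i * cnj (p i x) * L2_inner M (p i) \<phi>)"
      unfolding k_def by (intro L2_inner_sum_scale_left p \<phi>)
    then show ?thesis
      by (subst L2_inner_commute) (simp add: A_def L2_inner_commute[of M _ \<phi>] mult_ac)
  qed
  then have pw: "(cmod (A x))\<^sup>2 \<le> (L2_norm M (k x))\<^sup>2 * (L2_norm M \<phi>)\<^sup>2" for x
    using power_mono[OF L2_Cauchy_Schwarz[OF \<phi> k[of x]], of 2] by (simp add: power_mult_distrib mult.commute)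
  have hb: "has_bochner_integral M (\<lambda>x. (L2_norm M (k x))\<^sup>2)
           (\<Sum>i\<in>S. \<Sum>j\<in>S. c i * c j * (cmod (L2_inner M (p i) (p j)))\<^sup>2)"
    unfolding k_def by (rule Hilbert_Schmidt_kernel[OF p])
  have "A \<in> L2_fun M" unfolding A_def by (intro L2_fun_sum L2_fun_scale p)
  then have "(L2_norm M A)\<^sup>2 \<le> (\<integral>x. (L2_norm M (k x))\<^sup>2 * (L2_norm M \<phi>)\<^sup>2 \<partial>M)"
    unfolding L2_norm_power2[of M A] using hb pw
    by (intro integral_mono) (auto simp: has_bochner_integral_iff L2_fun_def)
  then show ?thesis using hb by (simp add: has_bochner_integral_iff A_def[abs_def])
qed

subsection \<open>Completeness and total boundedness\<close>

text \<open>Fatou's lemma for the squared moduli: the norm is lower semicontinuous under almost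
  everywhere convergence. It carries the Cauchy estimates over to the limit in
  \<open>L2_complete\<close>.\<close>

lemma L2_Fatou:
  assumes v: "\<And>k. v k \<in> L2_fun M" "\<And>k. L2_norm M (v k) \<le> C"
    and [measurable]: "w \<in> borel_measurable M"
    and lim: "AE x in M. (\<lambda>k. v k x) \<longlonglongrightarrow> w x"
  shows "w \<in> L2_fun M" "L2_norm M w \<le> C"
proof -
  have C: "0 \<le> C" using v(2)[of 0] L2_norm_nonneg[of M "v 0"] by linarith
  have [measurable]: "v k \<in> borel_measurable M" for k using v(1) by (rule L2_fun_measurable)
  have "(\<integral>\<^sup>+x. ennreal ((cmod (w x))\<^sup>2) \<partial>M) = (\<integral>\<^sup>+x. liminf (\<lambda>k. ennreal ((cmod (v k x))\<^sup>2)) \<partial>M)"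
  proof (rule nn_integral_cong_AE)
    show "AE x in M. ennreal ((cmod (w x))\<^sup>2) = liminf (\<lambda>k. ennreal ((cmod (v k x))\<^sup>2))"
      using lim
    proof eventually_elim
      case (elim x)
      then have "(\<lambda>k. ennreal ((cmod (v k x))\<^sup>2)) \<longlonglongrightarrow> ennreal ((cmod (w x))\<^sup>2)"
        by (intro tendsto_intros)
      then show ?case by (simp only: lim_imp_Liminf sequentially_bot not_False_eq_True)
    qed
  qed
  also have "\<dots> \<le> liminf (\<lambda>k. \<integral>\<^sup>+x. ennreal ((cmod (v k x))\<^sup>2) \<partial>M)"
    by (rule nn_integral_liminf) simp
  also have "\<dots> \<le> liminf (\<lambda>k::nat. ennreal (C\<^sup>2))"
  proof (intro Liminf_mono always_eventually allI)
    fix k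
    have "(\<integral>\<^sup>+x. ennreal ((cmod (v k x))\<^sup>2) \<partial>M) = ennreal ((L2_norm M (v k))\<^sup>2)"
      unfolding L2_norm_power2 by (rule nn_integral_eq_integral) (auto intro: L2_fun_integrable v)
    also have "\<dots> \<le> ennreal (C\<^sup>2)" using v(2)[of k] by (intro ennreal_leI power_mono) auto
    finally show "(\<integral>\<^sup>+x. ennreal ((cmod (v k x))\<^sup>2) \<partial>M) \<le> ennreal (C\<^sup>2)" .
  qed
  also have "\<dots> = ennreal (C\<^sup>2)" by (simp add: Liminf_const)
  finally have le: "(\<integral>\<^sup>+x. ennreal ((cmod (w x))\<^sup>2) \<partial>M) \<le> ennreal (C\<^sup>2)" .
  have int: "integrable M (\<lambda>x. (cmod (w x))\<^sup>2)"
    by (rule integrableI_bounded) (use le in \<open>auto simp: le_less_trans\<close>)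
  then show "w \<in> L2_fun M" by (intro L2_funI) simp_all
  have "ennreal ((L2_norm M w)\<^sup>2) \<le> ennreal (C\<^sup>2)"
    using le nn_integral_eq_integral[OF int] by (simp add: L2_norm_power2)
  then have "(L2_norm M w)\<^sup>2 \<le> C\<^sup>2" by (simp add: ennreal_le_iff)
  then show "L2_norm M w \<le> C" using C by (rule power2_le_imp_le)
qed

text \<open>Cauchy-Schwarz against the constant 1, which has norm 1 because the total mass is
  1.\<close>

lemma (in prob_space) L1_le_L2_norm:
  assumes f: "f \<in> L2_fun M"
  shows "integrable M (\<lambda>x. cmod (f x))" "(\<integral>x. cmod (f x) \<partial>M) \<le> L2_norm M f"
proof -
  have [measurable]: "f \<in> borel_measurable M" using f by (rule L2_fun_measurable)
  let ?F = "\<lambda>x. complex_of_real (cmod (f x))"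
  have F: "?F \<in> L2_fun M"
    by (rule L2_fun_dominated[OF _ f]) simp_all
  have one: "(\<lambda>x. 1) \<in> L2_fun M" by (rule L2_fun_const)
  have "integrable M ?F" using L2_mult_cnj_integrable[OF F one] by simp
  then show "integrable M (\<lambda>x. cmod (f x))" using complex_of_real_integrable_eq by blast
  have "L2_inner M ?F (\<lambda>x. 1) = complex_of_real (\<integral>x. cmod (f x) \<partial>M)"
    by (simp add: L2_inner_def)
  moreover have "L2_norm M (\<lambda>x. 1) = 1" "L2_norm M ?F = L2_norm M f"
    by (simp_all add: L2_norm_def prob_space)
  ultimately show "(\<integral>x. cmod (f x) \<partial>M) \<le> L2_norm M f"
    using L2_Cauchy_Schwarz[OF F one] by simp
qed

text \<open>The Riesz-Fischer argument: along a fast subsequence the increments have summable L1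
  norms, so their series converges absolutely almost everywhere; Fatou then bounds the distance to
  the pointwise limit.\<close>

lemma (in prob_space) L2_complete:
  assumes u: "\<And>n. u n \<in> L2_fun M"
    and cauchy: "\<And>e. e > 0 \<Longrightarrow> \<exists>N. \<forall>m\<ge>N. \<forall>n\<ge>N. L2_norm M (\<lambda>x. u m x - u n x) < e"
  obtains h where "h \<in> L2_fun M" "(\<lambda>n. L2_norm M (\<lambda>x. u n x - h x)) \<longlonglongrightarrow> 0"
proof -
  have [measurable]: "u n \<in> borel_measurable M" for n using u by (rule L2_fun_measurable)
  have "\<exists>N. \<forall>m\<ge>N. \<forall>n\<ge>N. L2_norm M (\<lambda>x. u m x - u n x) < (1/2)^k" for k :: nat
    by (rule cauchy) simp
  then obtain N where N: "\<And>k m n. m \<ge> N k \<Longrightarrow> n \<ge> N k \<Longrightarrow> L2_norm M (\<lambda>x. u m x - u n x) < (1/2)^k"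
    by metis
  \<comment> \<open>The running maximum keeps \<open>r\<close> increasing while \<open>r k\<close>
    stays beyond \<open>N k\<close>, so consecutive members differ by less than
    \<open>(1/2)^k\<close>.\<close>
  define r where "r = rec_nat (N 0) (\<lambda>k m. max m (N (Suc k)))"
  have r_Suc: "r (Suc k) = max (r k) (N (Suc k))" for k by (simp add: r_def)
  have rN: "r k \<ge> N k" for k by (cases k) (simp_all add: r_def)
  have "incseq r" by (rule incseq_SucI) (simp add: r_Suc)
  define d where "d k x = u (r (Suc k)) x - u (r k) x" for k x
  have dL2: "d k \<in> L2_fun M" for k unfolding d_def by (intro L2_fun_diff u)
  have [measurable]: "d k \<in> borel_measurable M" for k using dL2 by (rule L2_fun_measurable)
  have d_le: "(\<integral>x. cmod (d k x) \<partial>M) \<le> (1/2)^k" for k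
  proof -
    have "r (Suc k) \<ge> N k" "r k \<ge> N k" using rN[of k] by (simp_all add: r_Suc)
    from N[OF this] L1_le_L2_norm(2)[OF dL2, of k] show ?thesis by (simp add: d_def[abs_def])
  qed
  have "(\<integral>\<^sup>+x. (\<Sum>k. ennreal (cmod (d k x))) \<partial>M) = (\<Sum>k. \<integral>\<^sup>+x. ennreal (cmod (d k x)) \<partial>M)"
    by (rule nn_integral_suminf) simp
  also have "\<dots> \<le> (\<Sum>k. ennreal ((1/2)^k))"
  proof (rule suminf_le)
    fix k
    have "(\<integral>\<^sup>+x. ennreal (cmod (d k x)) \<partial>M) = ennreal (\<integral>x. cmod (d k x) \<partial>M)"
      by (rule nn_integral_eq_integral[OF L1_le_L2_norm(1)[OF dL2]]) simp
    then show "(\<integral>\<^sup>+x. ennreal (cmod (d k x)) \<partial>M) \<le> ennreal ((1/2)^k)"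
      using d_le by (simp add: ennreal_leI)
  qed auto
  also have "\<dots> = ennreal (\<Sum>k. (1/2)^k)"
    by (rule suminf_ennreal2) (auto intro: summable_geometric)
  finally have "(\<integral>\<^sup>+x. (\<Sum>k. ennreal (cmod (d k x))) \<partial>M) \<noteq> \<infinity>"
    by (metis ennreal_less_top infinity_ennreal_def leD)
  then have "AE x in M. (\<Sum>k. ennreal (cmod (d k x))) \<noteq> \<infinity>"
    by (rule nn_integral_PInf_AE[rotated]) simp
  then have conv: "AE x in M. convergent (\<lambda>k. u (r k) x)"
  proof eventually_elim
    case (elim x)
    then have "summable (\<lambda>k. cmod (d k x))"
      by (intro summable_suminf_not_top) auto
    then have "summable (\<lambda>k. d k x)" by (rule summable_norm_cancel)
    then have "convergent (\<lambda>n. \<Sum>k<n. d k x)" by (simp add: summable_iff_convergent)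
    then have "convergent (\<lambda>n. u (r n) x - u (r 0) x)"
      using sum_lessThan_telescope[of "\<lambda>k. u (r k) x"] by (simp add: d_def)
    then show ?case
      by (simp add: convergent_diff_const_right_iff)
  qed
  \<comment> \<open>On the null set of divergence \<open>lim\<close> has an arbitrary value;
    \<open>h\<close> is measurable all the same.\<close>
  define h where "h x = lim (\<lambda>k. u (r k) x)" for x
  have [measurable]: "h \<in> borel_measurable M"
    unfolding h_def by (rule borel_measurable_lim_metric) simp
  have lim: "AE x in M. (\<lambda>k. u (r k) x) \<longlonglongrightarrow> h x"
    using conv by eventually_elim (simp add: h_def convergent_LIMSEQ_iff)
  have close: "(\<lambda>x. u n x - h x) \<in> L2_fun M \<and> L2_norm M (\<lambda>x. u n x - h x) \<le> (1/2)^k"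
    if n: "n \<ge> r k" for n k
  proof -
    have L: "L2_norm M (\<lambda>x. u n x - u (r (i + k)) x) \<le> (1/2)^k" for i
      using N[of k n "r (i + k)"] n rN[of k] monoD[OF \<open>incseq r\<close>, of k "i + k"] by simp
    have "AE x in M. (\<lambda>i. u n x - u (r (i + k)) x) \<longlonglongrightarrow> u n x - h x"
      using lim by eventually_elim (intro tendsto_intros LIMSEQ_ignore_initial_segment)
    then show ?thesis
      using L2_Fatou[of "\<lambda>i x. u n x - u (r (i + k)) x" M "(1/2)^k" "\<lambda>x. u n x - h x"] L
      by (auto intro: L2_fun_diff u)
  qed
  show ?thesis
  proof (rule that)
    have "(\<lambda>x. u (r 0) x - (u (r 0) x - h x)) \<in> L2_fun M"
      by (rule L2_fun_diff[OF u]) (use close[of 0 "r 0"] in simp)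
    then show "h \<in> L2_fun M" by simp
    show "(\<lambda>n. L2_norm M (\<lambda>x. u n x - h x)) \<longlonglongrightarrow> 0"
    proof (rule LIMSEQ_I)
      fix e :: real assume "e > 0"
      then obtain k :: nat where k: "(1/2)^k < e" using real_arch_pow_inv[of e "1/2"] by auto
      then show "\<exists>no. \<forall>n\<ge>no. norm (L2_norm M (\<lambda>x. u n x - h x) - 0) < e"
        using close by (intro exI[of _ "r k"]) (auto intro: le_less_trans)
    qed
  qed
qed

text \<open>Formulated for functions and the seminorm, so that estimates need no representatives of
  classes. Centres may lie anywhere in \<open>L2_fun M\<close>, which makes finite nets easy to
  transport. \<open>L2_compact_closure_iff\<close> relates the notion to the topology on
  \<open>L2_space M\<close>.\<close>

definition L2_totally_bounded :: "'a measure \<Rightarrow> ('a \<Rightarrow> complex) set \<Rightarrow> bool" where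
  "L2_totally_bounded M F \<longleftrightarrow> (\<forall>e>0. \<exists>S. finite S \<and> S \<subseteq> L2_fun M \<and>
     (\<forall>f\<in>F. \<exists>s\<in>S. L2_norm M (\<lambda>x. f x - s x) < e))"

lemma L2_totally_boundedE:
  assumes "L2_totally_bounded M F" "e > 0"
  obtains S where "finite S" "S \<subseteq> L2_fun M" "\<And>f. f \<in> F \<Longrightarrow> \<exists>s\<in>S. L2_norm M (\<lambda>x. f x - s x) < e"
  using assms unfolding L2_totally_bounded_def by metis

lemma L2_totally_bounded_subset:
  "L2_totally_bounded M F \<Longrightarrow> G \<subseteq> F \<Longrightarrow> L2_totally_bounded M G"
  unfolding L2_totally_bounded_def by (meson subsetD)

text \<open>The metric notion wants centres in the set itself: each ball of radius
  \<open>e/2\<close> that meets \<open>F\<close> is replaced by a ball of radius \<open>e\<close>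
  around a point of \<open>F\<close> inside it.\<close>

lemma L2_totally_bounded_centers:
  assumes F: "F \<subseteq> L2_fun M" "L2_totally_bounded M F" and e: "e > 0"
  obtains S where "finite S" "S \<subseteq> F" "\<And>f. f \<in> F \<Longrightarrow> \<exists>s\<in>S. L2_norm M (\<lambda>x. s x - f x) < e"
proof -
  obtain S where S: "finite S" "S \<subseteq> L2_fun M"
    "\<And>f. f \<in> F \<Longrightarrow> \<exists>s\<in>S. L2_norm M (\<lambda>x. f x - s x) < e/2"
    by (rule L2_totally_boundedE[OF F(2) half_gt_zero[OF e]]) blast
  define S' where "S' = {s \<in> S. \<exists>f\<in>F. L2_norm M (\<lambda>x. f x - s x) < e/2}"
  obtain c where c: "\<And>s. s \<in> S' \<Longrightarrow> c s \<in> F \<and> L2_norm M (\<lambda>x. c s x - s x) < e/2"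
  proof -
    have "\<forall>s\<in>S'. \<exists>f. f \<in> F \<and> L2_norm M (\<lambda>x. f x - s x) < e/2" by (auto simp: S'_def)
    then show ?thesis using that by metis
  qed
  show ?thesis
  proof (rule that[of "c ` S'"])
    show "finite (c ` S')" using S(1) by (simp add: S'_def)
    show "c ` S' \<subseteq> F" using c by auto
    fix f assume f: "f \<in> F"
    then obtain s where s: "s \<in> S'" "L2_norm M (\<lambda>x. f x - s x) < e/2"
      using S(3)[OF f] unfolding S'_def by blast
    then have "s \<in> L2_fun M" "f \<in> L2_fun M" "c s \<in> L2_fun M" using c[of s] f F S by (auto simp: S'_def)
    then have "L2_norm M (\<lambda>x. c s x - f x) < e"
      using L2_norm_diff_triangle[of "c s" M s f] s(2) c[OF s(1)] L2_norm_minus_commute[of M f s] by simp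
    then show "\<exists>s\<in>c ` S'. L2_norm M (\<lambda>x. s x - f x) < e" using s(1) by blast
  qed
qed

text \<open>The approximating family may change with \<open>e\<close>; this lets a limit of
  finite-rank operators inherit their compactness.\<close>

lemma L2_totally_bounded_approx:
  assumes F: "F \<subseteq> L2_fun M"
    and "\<And>e. e > 0 \<Longrightarrow> \<exists>G. G \<subseteq> L2_fun M \<and> L2_totally_bounded M G \<and>
           (\<forall>f\<in>F. \<exists>g\<in>G. L2_norm M (\<lambda>x. f x - g x) \<le> e)"
  shows "L2_totally_bounded M F"
  unfolding L2_totally_bounded_def
proof (intro allI impI)
  fix e :: real assume e: "e > 0"
  then obtain G where G: "G \<subseteq> L2_fun M" "L2_totally_bounded M G"
    "\<And>f. f \<in> F \<Longrightarrow> \<exists>g\<in>G. L2_norm M (\<lambda>x. f x - g x) \<le> e/2"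
    using assms(2)[of "e/2"] by auto
  obtain S where S: "finite S" "S \<subseteq> L2_fun M" "\<And>g. g \<in> G \<Longrightarrow> \<exists>s\<in>S. L2_norm M (\<lambda>x. g x - s x) < e/2"
    using L2_totally_boundedE[OF G(2), of "e/2"] e by auto
  have "\<exists>s\<in>S. L2_norm M (\<lambda>x. f x - s x) < e" if f: "f \<in> F" for f
  proof -
    obtain g where g: "g \<in> G" "L2_norm M (\<lambda>x. f x - g x) \<le> e/2" using G(3) f by blast
    obtain s where s: "s \<in> S" "L2_norm M (\<lambda>x. g x - s x) < e/2" using S(3) g by blast
    have "L2_norm M (\<lambda>x. f x - s x) < e"
      using L2_norm_diff_triangle[of f M g s] f F g s G(1) S(2) by (auto simp: subset_iff)
    with s show ?thesis by blast
  qed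
  with S show "\<exists>S. finite S \<and> S \<subseteq> L2_fun M \<and> (\<forall>f\<in>F. \<exists>s\<in>S. L2_norm M (\<lambda>x. f x - s x) < e)" by blast
qed

lemma L2_totally_bounded_UN:
  assumes "finite I" "\<And>i. i \<in> I \<Longrightarrow> L2_totally_bounded M (F i)"
  shows "L2_totally_bounded M (\<Union>i\<in>I. F i)"
  unfolding L2_totally_bounded_def
proof (intro allI impI)
  fix e :: real assume "e > 0"
  then have "\<forall>i\<in>I. \<exists>S. finite S \<and> S \<subseteq> L2_fun M \<and> (\<forall>f\<in>F i. \<exists>s\<in>S. L2_norm M (\<lambda>x. f x - s x) < e)"
    using assms(2) unfolding L2_totally_bounded_def by blast
  then obtain S where "\<forall>i\<in>I. finite (S i) \<and> S i \<subseteq> L2_fun M \<and>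
      (\<forall>f\<in>F i. \<exists>s\<in>S i. L2_norm M (\<lambda>x. f x - s x) < e)" by metis
  then show "\<exists>S. finite S \<and> S \<subseteq> L2_fun M \<and>
      (\<forall>f\<in>(\<Union>i\<in>I. F i). \<exists>s\<in>S. L2_norm M (\<lambda>x. f x - s x) < e)"
    using assms(1) by (intro exI[of _ "\<Union>i\<in>I. S i"]) fastforce
qed

lemma L2_totally_bounded_add:
  assumes F: "F \<subseteq> L2_fun M" "L2_totally_bounded M F" and G: "G \<subseteq> L2_fun M" "L2_totally_bounded M G"
  shows "L2_totally_bounded M {\<lambda>x. f x + g x | f g. f \<in> F \<and> g \<in> G}"
  unfolding L2_totally_bounded_def
proof (intro allI impI)
  fix e :: real assume e: "e > 0"
  obtain S where S: "finite S" "S \<subseteq> L2_fun M" "\<And>f. f \<in> F \<Longrightarrow> \<exists>s\<in>S. L2_norm M (\<lambda>x. f x - s x) < e/2"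
    using L2_totally_boundedE[OF F(2), of "e/2"] e by auto
  obtain R where R: "finite R" "R \<subseteq> L2_fun M" "\<And>f. f \<in> G \<Longrightarrow> \<exists>s\<in>R. L2_norm M (\<lambda>x. f x - s x) < e/2"
    using L2_totally_boundedE[OF G(2), of "e/2"] e by auto
  let ?U = "(\<lambda>(s, r) x. s x + r x) ` (S \<times> R)"
  have "\<exists>s\<in>?U. L2_norm M (\<lambda>x. (f x + g x) - s x) < e" if fg: "f \<in> F" "g \<in> G" for f g
  proof -
    obtain s r where sr: "s \<in> S" "L2_norm M (\<lambda>x. f x - s x) < e/2" "r \<in> R" "L2_norm M (\<lambda>x. g x - r x) < e/2"
      using S(3)[OF fg(1)] R(3)[OF fg(2)] by blast
    have "L2_norm M (\<lambda>x. (f x - s x) + (g x - r x)) \<le> L2_norm M (\<lambda>x. f x - s x) + L2_norm M (\<lambda>x. g x - r x)"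
      using fg sr F G S R by (intro L2_norm_add_le L2_fun_diff) auto
    then have "L2_norm M (\<lambda>x. (f x + g x) - (s x + r x)) < e"
      using sr by (simp add: algebra_simps)
    with sr show ?thesis by (intro bexI[of _ "\<lambda>x. s x + r x"]) auto
  qed
  moreover have "?U \<subseteq> L2_fun M" using S(2) R(2) by (auto intro!: L2_fun_add)
  ultimately show "\<exists>S. finite S \<and> S \<subseteq> L2_fun M \<and>
      (\<forall>f\<in>{\<lambda>x. f x + g x | f g. f \<in> F \<and> g \<in> G}. \<exists>s\<in>S. L2_norm M (\<lambda>x. f x - s x) < e)"
    using S(1) R(1) by (intro exI[of _ ?U]) auto
qed

lemma (in finite_measure) L2_fun_Lipschitz:
  assumes "f \<in> L2_fun M" and lip: "\<And>z w. cmod (\<phi> z - \<phi> w) \<le> L * cmod (z - w)"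
  shows "(\<lambda>x. \<phi> (f x)) \<in> L2_fun M"
proof -
  have [measurable]: "f \<in> borel_measurable M" using assms(1) by (rule L2_fun_measurable)
  have L: "0 \<le> L" using lip[of 1 0] by (auto intro: order_trans[OF norm_ge_zero])
  have "L-lipschitz_on UNIV \<phi>"
    by (rule lipschitz_onI) (use lip L in \<open>auto simp: dist_norm\<close>)
  then have [measurable]: "\<phi> \<in> borel_measurable borel"
    by (intro borel_measurable_continuous_onI lipschitz_on_continuous_on)
  have "(\<lambda>x. \<phi> (f x) - \<phi> 0) \<in> L2_fun M"
  proof (rule L2_fun_dominated[OF _ L2_fun_scale[OF assms(1), of "of_real L"]])
    show "cmod (\<phi> (f x) - \<phi> 0) \<le> cmod (of_real L * f x)" for x
      using lip[of "f x" 0] L by (simp add: norm_mult)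
  qed simp
  from L2_fun_add[OF this L2_fun_const[of "\<phi> 0"]] show ?thesis by simp
qed

lemma (in finite_measure) L2_norm_Lipschitz:
  assumes f: "f \<in> L2_fun M" "g \<in> L2_fun M" and lip: "\<And>z w. cmod (\<phi> z - \<phi> w) \<le> L * cmod (z - w)"
  shows "L2_norm M (\<lambda>x. \<phi> (f x) - \<phi> (g x)) \<le> L * L2_norm M (\<lambda>x. f x - g x)"
proof -
  have L: "0 \<le> L" using lip[of 1 0] by (auto intro: order_trans[OF norm_ge_zero])
  have "(L2_norm M (\<lambda>x. \<phi> (f x) - \<phi> (g x)))\<^sup>2 \<le> (L2_norm M (\<lambda>x. of_real L * (f x - g x)))\<^sup>2"
    unfolding L2_norm_power2
  proof (rule integral_mono)
    show "integrable M (\<lambda>x. (cmod (\<phi> (f x) - \<phi> (g x)))\<^sup>2)"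
      by (intro L2_fun_integrable L2_fun_diff L2_fun_Lipschitz[OF _ lip] f)
    show "integrable M (\<lambda>x. (cmod (of_real L * (f x - g x)))\<^sup>2)"
      by (intro L2_fun_integrable L2_fun_scale L2_fun_diff f)
    show "(cmod (\<phi> (f x) - \<phi> (g x)))\<^sup>2 \<le> (cmod (of_real L * (f x - g x)))\<^sup>2" for x
      using lip[of "f x" "g x"] L by (intro power_mono) (auto simp: norm_mult)
  qed
  then have "L2_norm M (\<lambda>x. \<phi> (f x) - \<phi> (g x)) \<le> L2_norm M (\<lambda>x. of_real L * (f x - g x))"
    by (rule power2_le_imp_le) simp
  then show ?thesis using L by (simp only: L2_norm_scale norm_of_real abs_of_nonneg)
qed

lemma (in finite_measure) L2_totally_bounded_Lipschitz:
  assumes F: "F \<subseteq> L2_fun M" "L2_totally_bounded M F"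
    and lip: "\<And>z w. cmod (\<phi> z - \<phi> w) \<le> L * cmod (z - w)"
  shows "L2_totally_bounded M ((\<lambda>f x. \<phi> (f x)) ` F)"
  unfolding L2_totally_bounded_def
proof (intro allI impI)
  fix e :: real assume e: "e > 0"
  have L: "0 \<le> L" using lip[of 1 0] by (auto intro: order_trans[OF norm_ge_zero])
  \<comment> \<open>\<open>L + 1\<close> in place of \<open>L\<close> covers \<open>L = 0\<close>
    and makes the last estimate strict.\<close>
  obtain S where S: "finite S" "S \<subseteq> L2_fun M"
    "\<And>f. f \<in> F \<Longrightarrow> \<exists>s\<in>S. L2_norm M (\<lambda>x. f x - s x) < e / (L + 1)"
    using L2_totally_boundedE[OF F(2), of "e / (L + 1)"] e L by auto
  have "\<exists>s\<in>S. L2_norm M (\<lambda>x. \<phi> (f x) - \<phi> (s x)) < e" if f: "f \<in> F" for f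
  proof -
    obtain s where s: "s \<in> S" "L2_norm M (\<lambda>x. f x - s x) < e / (L + 1)" using S(3) f by blast
    have "L2_norm M (\<lambda>x. \<phi> (f x) - \<phi> (s x)) \<le> L * L2_norm M (\<lambda>x. f x - s x)"
      using f s F S by (intro L2_norm_Lipschitz lip) auto
    also have "\<dots> \<le> L * (e / (L + 1))" using s L by (intro mult_left_mono) auto
    also have "\<dots> < e" using L e by (simp add: field_simps)
    finally show ?thesis using s by blast
  qed
  then show "\<exists>S. finite S \<and> S \<subseteq> L2_fun M \<and>
      (\<forall>f\<in>(\<lambda>f x. \<phi> (f x)) ` F. \<exists>s\<in>S. L2_norm M (\<lambda>x. f x - s x) < e)"
    using S by (intro exI[of _ "(\<lambda>f x. \<phi> (f x)) ` S"]) (auto intro: L2_fun_Lipschitz[OF _ lip])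
qed

lemma L2_totally_bounded_line:
  assumes f: "f \<in> L2_fun M"
  shows "L2_totally_bounded M {\<lambda>x. a * f x | a. cmod a \<le> R}"
  unfolding L2_totally_bounded_def
proof (intro allI impI)
  fix e :: real assume e: "e > 0"
  define N where "N = L2_norm M f"
  have N: "0 \<le> N" by (simp add: N_def)
  obtain K where K: "finite K" "cball (0::complex) R \<subseteq> (\<Union>z\<in>K. ball z (e / (N + 1)))"
    using compact_eq_totally_bounded[of "cball (0::complex) R"] e N
    by (metis add_nonneg_pos compact_cball divide_pos_pos zero_less_one)
  have "\<exists>z\<in>K. L2_norm M (\<lambda>x. a * f x - z * f x) < e" if a: "cmod a \<le> R" for a
  proof -
    obtain z where z: "z \<in> K" "cmod (z - a) < e / (N + 1)"
      using a K(2) by (fastforce simp: dist_norm)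
    have "L2_norm M (\<lambda>x. (a - z) * f x) \<le> cmod (z - a) * N"
      by (simp only: L2_norm_scale N_def norm_minus_commute order_refl)
    also have "\<dots> \<le> e / (N + 1) * N" using z N by (intro mult_right_mono) auto
    also have "\<dots> < e" using N e by (simp add: field_simps)
    finally show ?thesis using z by (auto simp: left_diff_distrib)
  qed
  then show "\<exists>S. finite S \<and> S \<subseteq> L2_fun M \<and>
      (\<forall>g\<in>{\<lambda>x. a * f x | a. cmod a \<le> R}. \<exists>s\<in>S. L2_norm M (\<lambda>x. g x - s x) < e)"
    using K(1) by (intro exI[of _ "(\<lambda>z x. z * f x) ` K"]) (auto intro: L2_fun_scale f)
qed

text \<open>The bound is on the coefficients and not on the norms, so linearly dependent
  \<open>p i\<close> cause no trouble. One line is added at a time, and the compactness comes from a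
  disc of scalars.\<close>

lemma L2_totally_bounded_span:
  assumes "finite I" "\<And>i. i \<in> I \<Longrightarrow> p i \<in> L2_fun M"
  shows "L2_totally_bounded M {\<lambda>x. \<Sum>i\<in>I. a i * p i x | a. \<forall>i\<in>I. cmod (a i) \<le> R}"
  using assms
proof (induction I)
  case empty
  show ?case
    using L2_fun_zero[of M] by (auto simp: L2_totally_bounded_def intro!: exI[of _ "{\<lambda>x. 0}"])
next
  case (insert j I)
  let ?G = "{\<lambda>x. \<Sum>i\<in>I. a i * p i x | a. \<forall>i\<in>I. cmod (a i) \<le> R}"
  let ?L = "{\<lambda>x. a * p j x | a. cmod a \<le> R}"
  have "L2_totally_bounded M {\<lambda>x. f x + g x | f g. f \<in> ?L \<and> g \<in> ?G}"
    using insert by (intro L2_totally_bounded_add L2_totally_bounded_line insert.IH)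
      (auto intro!: L2_fun_sum L2_fun_scale)
  then show ?case
  proof (rule L2_totally_bounded_subset)
    show "{\<lambda>x. \<Sum>i\<in>insert j I. a i * p i x | a. \<forall>i\<in>insert j I. cmod (a i) \<le> R}
      \<subseteq> {\<lambda>x. f x + g x | f g. f \<in> ?L \<and> g \<in> ?G}"
    proof clarify
      fix a assume a: "\<forall>i\<in>insert j I. cmod (a i) \<le> R"
      have "(\<lambda>x. a j * p j x) \<in> ?L" "(\<lambda>x. \<Sum>i\<in>I. a i * p i x) \<in> ?G" using a by auto
      then show "\<exists>f g. (\<lambda>x. \<Sum>i\<in>insert j I. a i * p i x) = (\<lambda>x. f x + g x) \<and> f \<in> ?L \<and> g \<in> ?G"
        using insert.hyps
        by (intro exI[of _ "\<lambda>x. a j * p j x"] exI[of _ "\<lambda>x. \<Sum>i\<in>I. a i * p i x"]) (simp add: sum.insert)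
    qed
  qed
qed

section \<open>Compact closures of sets of classes\<close>

lemma (in prob_space) L2_mcomplete: "Metric_space.mcomplete (L2_space M) (L2_dist M)"
proof -
  interpret L2: Metric_space "L2_space M" "L2_dist M" by (rule L2_Metric_space)
  show ?thesis
    unfolding L2.mcomplete_def
  proof (intro allI impI)
    fix \<sigma> assume \<sigma>: "L2.MCauchy \<sigma>"
    then have "range \<sigma> \<subseteq> L2_space M" by (simp add: L2.MCauchy_def)
    then have "\<forall>n. \<exists>f. f \<in> L2_fun M \<and> \<sigma> n = L2_class M f"
      unfolding L2_space_def by blast
    then obtain u where u: "\<And>n. u n \<in> L2_fun M" "\<And>n. \<sigma> n = L2_class M (u n)" by metis
    have "\<exists>N. \<forall>m\<ge>N. \<forall>n\<ge>N. L2_norm M (\<lambda>x. u m x - u n x) < e" if "e > 0" for e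
      using \<sigma> that unfolding L2.MCauchy_def by (simp add: u L2_dist_class)
    then obtain h where h: "h \<in> L2_fun M" "(\<lambda>n. L2_norm M (\<lambda>x. u n x - h x)) \<longlonglongrightarrow> 0"
      using L2_complete[of u] u(1) by blast
    moreover have "L2_class M h \<in> L2_space M" "\<sigma> n \<in> L2_space M" for n
      using h u by (auto simp: L2_space_def)
    ultimately have "limitin L2.mtopology \<sigma> (L2_class M h) sequentially"
      using u(1) by (simp add: L2.limitin_metric_dist_null u(2) L2_dist_class)
    then show "\<exists>x. limitin L2.mtopology \<sigma> x sequentially" by blast
  qed
qed

text \<open>Completeness makes compact closure the same as total boundedness. From here on, the
  topology in the definition of \<open>kronecker_sets\<close> is replaced by finite nets of
  functions.\<close>

lemma (in prob_space) L2_compact_closure_iff: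
  assumes F: "F \<subseteq> L2_fun M"
  shows "compactin (L2_topology M) (L2_topology M closure_of (L2_class M ` F)) \<longleftrightarrow>
    L2_totally_bounded M F"
proof -
  interpret L2: Metric_space "L2_space M" "L2_dist M" by (rule L2_Metric_space)
  have sub: "L2_class M ` F \<subseteq> L2_space M" using F by (auto simp: L2_space_def)
  have ball: "L2_class M f \<in> L2.mball (L2_class M s) e \<longleftrightarrow> L2_norm M (\<lambda>x. s x - f x) < e"
    if "s \<in> F" "f \<in> F" for s f e
    using that F sub by (auto simp: L2.mball_def L2_dist_class subset_iff)
  have "compactin L2.mtopology (L2.mtopology closure_of (L2_class M ` F)) \<longleftrightarrow>
      L2.mtotally_bounded (L2_class M ` F)"
    using L2.mtotally_bounded_eq_compact_closure_of[OF L2_mcomplete] sub by blast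
  also have "\<dots> \<longleftrightarrow> L2_totally_bounded M F"
  proof
    assume tb: "L2.mtotally_bounded (L2_class M ` F)"
    show "L2_totally_bounded M F"
      unfolding L2_totally_bounded_def
    proof (intro allI impI)
      fix e :: real assume "e > 0"
      then obtain K where K: "finite K" "K \<subseteq> L2_class M ` F" "L2_class M ` F \<subseteq> (\<Union>x\<in>K. L2.mball x e)"
        using tb unfolding L2.mtotally_bounded_def by meson
      obtain S where S: "finite S" "S \<subseteq> F" "K = L2_class M ` S"
        using finite_subset_image[OF K(1,2)] by blast
      have "\<exists>s\<in>S. L2_norm M (\<lambda>x. f x - s x) < e" if f: "f \<in> F" for f
      proof -
        obtain s where s: "s \<in> S" "L2_class M f \<in> L2.mball (L2_class M s) e" using K(3) f S(3) by blast
        then show ?thesis using ball[of s f e] f S(2) by (auto simp: L2_norm_minus_commute[of M f])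
      qed
      with S F show "\<exists>S. finite S \<and> S \<subseteq> L2_fun M \<and> (\<forall>f\<in>F. \<exists>s\<in>S. L2_norm M (\<lambda>x. f x - s x) < e)"
        by blast
    qed
  next
    assume tb: "L2_totally_bounded M F"
    show "L2.mtotally_bounded (L2_class M ` F)"
      unfolding L2.mtotally_bounded_def
    proof (intro allI impI)
      fix e :: real assume "e > 0"
      from L2_totally_bounded_centers[OF F tb this] obtain S where S: "finite S" "S \<subseteq> F"
        "\<And>f. f \<in> F \<Longrightarrow> \<exists>s\<in>S. L2_norm M (\<lambda>x. s x - f x) < e" by metis
      then have "L2_class M ` F \<subseteq> (\<Union>x\<in>L2_class M ` S. L2.mball x e)"
        using ball by (fastforce simp: subset_iff)
      with S show "\<exists>K. finite K \<and> K \<subseteq> L2_class M ` F \<and> L2_class M ` F \<subseteq> (\<Union>x\<in>K. L2.mball x e)"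
        by (intro exI[of _ "L2_class M ` S"]) auto
    qed
  qed
  finally show ?thesis .
qed

subsection \<open>Strips of irrational slope\<close>

lemma mem_strip_iff:
  "v \<in> strip \<beta> b \<longleftrightarrow> \<bar>real_of_int (snd v) - \<beta> * real_of_int (fst v)\<bar> \<le> b"
  by (cases v) (auto simp: strip_def)

lemma strip_add: "u \<in> strip \<beta> b \<Longrightarrow> v \<in> strip \<beta> c \<Longrightarrow> u + v \<in> strip \<beta> (b + c)"
  unfolding mem_strip_iff fst_add snd_add of_int_add distrib_left by linarith

lemma strip_diff: "u \<in> strip \<beta> b \<Longrightarrow> v \<in> strip \<beta> c \<Longrightarrow> u - v \<in> strip \<beta> (b + c)"
  unfolding mem_strip_iff fst_diff snd_diff of_int_diff right_diff_distrib by linarith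

lemma strip_mono: "b \<le> c \<Longrightarrow> strip \<beta> b \<subseteq> strip \<beta> c"
  by (auto simp: mem_strip_iff)

lemma zero_in_strip: "0 \<le> b \<Longrightarrow> 0 \<in> strip \<beta> b"
  by (simp add: mem_strip_iff)

text \<open>A rational approximation \<open>(k, h)\<close> of the slope is a vector almost parallel to the strip;
  its multiples shift the thin strip across the wide one.\<close>

lemma strip_finite_cover:
  assumes irr: "\<beta> \<notin> \<rat>" and d: "d > 0"
  obtains V where "finite V" "\<And>v. v \<in> strip \<beta> c \<Longrightarrow> \<exists>u\<in>V. v - u \<in> strip \<beta> d"
proof -
  obtain N :: nat where N: "N > 0" "1 / real N < d"
    using d real_arch_inverse[of d] by (auto simp: inverse_eq_divide)
  obtain h k :: int where hk: "0 < k" "\<bar>of_int k * \<beta> - of_int h\<bar> < 1 / N"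
    using Dirichlet_approx[OF N(1), of \<beta>] by blast
  \<comment> \<open>\<open>\<theta>\<close> is the signed vertical offset of \<open>(k, h)\<close>
    from the line of slope \<open>\<beta>\<close>: nonzero by irrationality and smaller than
    \<open>d\<close> by Dirichlet's theorem. Subtracting a suitable multiple of
    \<open>(k, h)\<close> leaves an offset of modulus at most that of
    \<open>\<theta>\<close>.\<close>
  define \<theta> where "\<theta> = real_of_int h - \<beta> * of_int k"
  have \<theta>: "\<theta> \<noteq> 0"
  proof
    assume "\<theta> = 0"
    then have "\<beta> = of_int h / of_int k" using hk(1) by (simp add: \<theta>_def field_simps)
    with irr show False by simp
  qed
  have \<theta>d: "\<bar>\<theta>\<bar> < d" using hk(2) N(2) by (simp add: \<theta>_def algebra_simps abs_minus_commute)
  define J where "J = \<lceil>c / \<bar>\<theta>\<bar>\<rceil> + 1"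
  show ?thesis
  proof (rule that[of "(\<lambda>j. (j * k, j * h)) ` {-J..J}"])
    fix v assume v: "v \<in> strip \<beta> c"
    define s where "s = real_of_int (snd v) - \<beta> * real_of_int (fst v)"
    define j where "j = \<lfloor>s / \<theta>\<rfloor>"
    have "\<bar>s / \<theta>\<bar> \<le> c / \<bar>\<theta>\<bar>" using v by (simp add: s_def mem_strip_iff divide_right_mono)
    then have "- (c / \<bar>\<theta>\<bar>) \<le> s / \<theta>" "s / \<theta> \<le> c / \<bar>\<theta>\<bar>" by linarith+
    then have "- J \<le> j" "j \<le> J" unfolding j_def J_def by linarith+
    then have "j \<in> {-J..J}" by simp
    moreover have "v - (j * k, j * h) \<in> strip \<beta> d"
    proof -
      have "\<bar>s - j * \<theta>\<bar> = \<bar>s / \<theta> - j\<bar> * \<bar>\<theta>\<bar>"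
      proof -
        have "s - j * \<theta> = (s / \<theta> - j) * \<theta>" using \<theta> by (simp add: left_diff_distrib)
        then show ?thesis by (simp only: abs_mult)
      qed
      also have "\<dots> \<le> 1 * \<bar>\<theta>\<bar>"
      proof (rule mult_right_mono)
        show "\<bar>s / \<theta> - j\<bar> \<le> 1" unfolding j_def by linarith
      qed simp
      finally have "\<bar>s - j * \<theta>\<bar> \<le> d" using \<theta>d by linarith
      moreover have "real_of_int (snd (v - (j * k, j * h))) - \<beta> * real_of_int (fst (v - (j * k, j * h))) = s - j * \<theta>"
        by (simp add: s_def \<theta>_def algebra_simps)
      ultimately show ?thesis unfolding mem_strip_iff by (simp only:)
    qed
    ultimately show "\<exists>u\<in>(\<lambda>j. (j * k, j * h)) ` {-J..J}. v - u \<in> strip \<beta> d" by blast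
  qed simp
qed

text \<open>Over each first coordinate the strip is an interval of length \<open>2 * r\<close>,
  which contains at most \<open>2 * r + 1\<close> integers.\<close>

lemma finite_strip_window: "finite (strip \<beta> r \<inter> ({a..b} \<times> UNIV))"
  and card_strip_window_le:
    "0 \<le> r \<Longrightarrow> real (card (strip \<beta> r \<inter> ({a..b} \<times> UNIV))) \<le> real (nat (b - a + 1)) * (2 * r + 1)"
proof -
  let ?I = "\<lambda>m. {\<lceil>\<beta> * of_int m - r\<rceil>..\<lfloor>\<beta> * of_int m + r\<rfloor>}"
  let ?A = "\<Union>m\<in>{a..b}. {m} \<times> ?I m"
  have sub: "strip \<beta> r \<inter> ({a..b} \<times> UNIV) \<subseteq> ?A"
    by (auto simp: strip_def ceiling_le_iff le_floor_iff)
  then show "finite (strip \<beta> r \<inter> ({a..b} \<times> UNIV))" by (rule finite_subset) auto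
  assume r: "0 \<le> r"
  have "card (strip \<beta> r \<inter> ({a..b} \<times> UNIV)) \<le> card ?A"
    by (rule card_mono[OF _ sub]) auto
  also have "\<dots> \<le> (\<Sum>m\<in>{a..b}. card ({m} \<times> ?I m))" by (rule card_UN_le) simp
  finally have "real (card (strip \<beta> r \<inter> ({a..b} \<times> UNIV))) \<le> real (\<Sum>m\<in>{a..b}. card ({m} \<times> ?I m))"
    by (rule of_nat_mono)
  also have "\<dots> = (\<Sum>m\<in>{a..b}. real (card ({m} \<times> ?I m)))" by simp
  also have "\<dots> \<le> (\<Sum>m\<in>{a..b}. 2 * r + 1)"
  proof (rule sum_mono)
    fix m
    have "real_of_int (\<lfloor>\<beta> * of_int m + r\<rfloor> - \<lceil>\<beta> * of_int m - r\<rceil> + 1) \<le> 2 * r + 1" by linarith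
    then show "real (card ({m} \<times> ?I m)) \<le> 2 * r + 1"
      using r by (simp add: card_cartesian_product_singleton)
  qed
  finally show "real (card (strip \<beta> r \<inter> ({a..b} \<times> UNIV))) \<le> real (nat (b - a + 1)) * (2 * r + 1)"
    by simp
qed

text \<open>A thin strip misses many columns, so points cannot be counted column by column. Rounding
  puts a point of the strip of width 1 into every column, and one of finitely many shifts moves it
  into the strip of width \<open>b\<close>; each point there is reached at most
  \<open>card V\<close> times.\<close>

lemma card_strip_upto_ge:
  assumes irr: "\<beta> \<notin> \<rat>" and b: "b > 0"
  obtains C where "C > 0" "\<forall>\<^sub>F k in sequentially. real k \<le> C * real (card (strip_upto \<beta> b k))"
proof -
  obtain V where V: "finite V" "\<And>v. v \<in> strip \<beta> 1 \<Longrightarrow> \<exists>u\<in>V. v - u \<in> strip \<beta> b"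
    using strip_finite_cover[OF irr b, of 1] by metis
  define pt where "pt m = (m, round (\<beta> * of_int m))" for m :: int
  have "pt m \<in> strip \<beta> 1" for m
    using of_int_round_abs_le[of "\<beta> * of_int m"] by (simp add: mem_strip_iff pt_def)
  then have "\<forall>m. \<exists>u. u \<in> V \<and> pt m - u \<in> strip \<beta> b" using V(2) by blast
  then obtain u where u: "\<And>m. u m \<in> V" "\<And>m. pt m - u m \<in> strip \<beta> b" by metis
  define P where "P = Max (insert 0 ((\<lambda>v. \<bar>fst v\<bar>) ` V))"
  have P: "\<bar>fst v\<bar> \<le> P" if "v \<in> V" for v
    unfolding P_def using V(1) that by (intro Max_ge) auto
  have P0: "0 \<le> P" unfolding P_def using V(1) by (intro Max_ge) auto
  have "V \<noteq> {}" using u(1) by auto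
  then have cV: "card V > 0" using V(1) by (simp add: card_gt_0_iff)
  \<comment> \<open>Shifts change the first coordinate by at most \<open>P\<close>, so the columns
    from \<open>P\<close> to \<open>k - 1 - P\<close> stay in the window;
    \<open>k \<ge> 4 * P\<close> leaves at least half of all columns.\<close>
  have "real k \<le> 2 * real (card V) * real (card (strip_upto \<beta> b k))" if k: "k \<ge> nat (4 * P)" for k
  proof -
    \<comment> \<open>Recording the shift as second component lets the column be recovered from the
      pair.\<close>
    have "inj_on (\<lambda>m. (pt m - u m, u m)) {P..int k - 1 - P}"
    proof (rule inj_onI)
      fix m m' assume "(pt m - u m, u m) = (pt m' - u m', u m')"
      then have "pt m = pt m'" by (metis Pair_inject diff_add_cancel)
      then show "m = m'" by (simp add: pt_def)
    qed
    moreover have "(\<lambda>m. (pt m - u m, u m)) ` {P..int k - 1 - P} \<subseteq> strip_upto \<beta> b k \<times> V"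
    proof (rule image_subsetI)
      fix m assume m: "m \<in> {P..int k - 1 - P}"
      have "fst (pt m - u m) \<in> {0..int k - 1}" using m P[OF u(1), of m] by (auto simp: pt_def)
      then show "(pt m - u m, u m) \<in> strip_upto \<beta> b k \<times> V"
        using u[of m] by (simp add: strip_upto_def mem_Times_iff)
    qed
    ultimately have "card {P..int k - 1 - P} \<le> card (strip_upto \<beta> b k \<times> V)"
      using V(1) by (intro card_inj_on_le) (auto simp: finite_strip_upto)
    then have "nat (int k - 2 * P) \<le> card (strip_upto \<beta> b k) * card V"
      by (simp add: card_cartesian_product algebra_simps)
    moreover have "k \<le> 2 * nat (int k - 2 * P)" using k P0 by linarith
    ultimately have "k \<le> 2 * (card (strip_upto \<beta> b k) * card V)" by linarith
    then have "real k \<le> real (2 * (card (strip_upto \<beta> b k) * card V))" by (rule of_nat_mono)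
    then show ?thesis by (simp add: mult_ac)
  qed
  then show ?thesis
    using that[of "2 * real (card V)"] cV by (auto simp: eventually_sequentially)
qed

subsection \<open>Quadratic forms in finitely supported weights\<close>

text \<open>The bilinear form of the kernel. Summing over supports lets weights be functions on the
  whole index type, so that weights with different supports can be subtracted and shifted
  freely.\<close>

definition kernel_form :: "('i \<Rightarrow> 'i \<Rightarrow> real) \<Rightarrow> ('i \<Rightarrow> real) \<Rightarrow> ('i \<Rightarrow> real) \<Rightarrow> real" where
  "kernel_form \<kappa> c d = (\<Sum>u | c u \<noteq> 0. \<Sum>v | d v \<noteq> 0. c u * d v * \<kappa> u v)"

lemma kernel_form_eq:
  assumes "finite S" "\<And>u. c u \<noteq> 0 \<Longrightarrow> u \<in> S" "finite R" "\<And>u. d u \<noteq> 0 \<Longrightarrow> u \<in> R"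
  shows "kernel_form \<kappa> c d = (\<Sum>u\<in>S. \<Sum>v\<in>R. c u * d v * \<kappa> u v)"
proof -
  have "kernel_form \<kappa> c d = (\<Sum>u\<in>S. \<Sum>v | d v \<noteq> 0. c u * d v * \<kappa> u v)"
    unfolding kernel_form_def by (rule sum.mono_neutral_left) (use assms in auto)
  also have "\<dots> = (\<Sum>u\<in>S. \<Sum>v\<in>R. c u * d v * \<kappa> u v)"
    by (intro sum.cong refl sum.mono_neutral_left) (use assms in auto)
  finally show ?thesis .
qed

lemma kernel_form_diff:
  assumes fin: "finite {u. c u \<noteq> 0}" "finite {u. d u \<noteq> 0}" and sym: "\<And>u v. \<kappa> u v = \<kappa> v u"
  shows "kernel_form \<kappa> (\<lambda>u. c u - d u) (\<lambda>u. c u - d u) =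
    kernel_form \<kappa> c c + kernel_form \<kappa> d d - 2 * kernel_form \<kappa> c d"
proof -
  let ?S = "{u. c u \<noteq> 0} \<union> {u. d u \<noteq> 0}"
  note eq = kernel_form_eq[of ?S _ ?S]
  have "kernel_form \<kappa> d c = kernel_form \<kappa> c d"
    unfolding kernel_form_def by (subst sum.swap) (intro sum.cong refl, simp add: sym mult_ac)
  moreover have "kernel_form \<kappa> (\<lambda>u. c u - d u) (\<lambda>u. c u - d u) =
    kernel_form \<kappa> c c + kernel_form \<kappa> d d - kernel_form \<kappa> c d - kernel_form \<kappa> d c"
  proof -
    have "kernel_form \<kappa> (\<lambda>u. c u - d u) (\<lambda>u. c u - d u) = (\<Sum>u\<in>?S. \<Sum>v\<in>?S.
       c u * c v * \<kappa> u v + d u * d v * \<kappa> u v - c u * d v * \<kappa> u v - d u * c v * \<kappa> u v)"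
      by (subst eq) (auto simp: fin algebra_simps intro!: sum.cong)
    also have "\<dots> = (\<Sum>u\<in>?S. \<Sum>v\<in>?S. c u * c v * \<kappa> u v) + (\<Sum>u\<in>?S. \<Sum>v\<in>?S. d u * d v * \<kappa> u v)
       - (\<Sum>u\<in>?S. \<Sum>v\<in>?S. c u * d v * \<kappa> u v) - (\<Sum>u\<in>?S. \<Sum>v\<in>?S. d u * c v * \<kappa> u v)"
      by (simp only: sum_subtractf sum.distrib)
    finally show ?thesis by (simp add: eq fin)
  qed
  ultimately show ?thesis by simp
qed

text \<open>The identity holds term by term. Midpoints appear because the midpoint of two weights is
  again a weight, so an infimum over weights bounds its form from below.\<close>

lemma kernel_form_parallelogram:
  assumes fin: "finite {u. c u \<noteq> 0}" "finite {u. d u \<noteq> 0}"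
  shows "kernel_form \<kappa> (\<lambda>u. c u - d u) (\<lambda>u. c u - d u) = 2 * kernel_form \<kappa> c c + 2 * kernel_form \<kappa> d d
    - 4 * kernel_form \<kappa> (\<lambda>u. (c u + d u) / 2) (\<lambda>u. (c u + d u) / 2)"
proof -
  let ?S = "{u. c u \<noteq> 0} \<union> {u. d u \<noteq> 0}"
  note eq = kernel_form_eq[of ?S _ ?S]
  have S: "u \<in> ?S" if "(c u + d u) / 2 \<noteq> 0" for u using that by auto
  have pt: "(a - b) * (a' - b') * k =
      2 * (a * a' * k) + 2 * (b * b' * k) - 4 * ((a + b) / 2 * ((a' + b') / 2) * k)"
    for a b a' b' k :: real by (simp add: field_simps)
  have "kernel_form \<kappa> (\<lambda>u. c u - d u) (\<lambda>u. c u - d u) = (\<Sum>u\<in>?S. \<Sum>v\<in>?S.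
     2 * (c u * c v * \<kappa> u v) + 2 * (d u * d v * \<kappa> u v)
       - 4 * ((c u + d u) / 2 * ((c v + d v) / 2) * \<kappa> u v))"
    by (subst eq) (auto simp: fin pt intro!: sum.cong)
  also have "\<dots> = 2 * (\<Sum>u\<in>?S. \<Sum>v\<in>?S. c u * c v * \<kappa> u v) + 2 * (\<Sum>u\<in>?S. \<Sum>v\<in>?S. d u * d v * \<kappa> u v)
     - 4 * (\<Sum>u\<in>?S. \<Sum>v\<in>?S. (c u + d u) / 2 * ((c v + d v) / 2) * \<kappa> u v)"
    by (simp only: sum_subtractf sum.distrib sum_distrib_left)
  also have "(\<Sum>u\<in>?S. \<Sum>v\<in>?S. c u * c v * \<kappa> u v) = kernel_form \<kappa> c c"
    by (subst eq) (auto simp: fin)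
  also have "(\<Sum>u\<in>?S. \<Sum>v\<in>?S. d u * d v * \<kappa> u v) = kernel_form \<kappa> d d"
    by (subst eq) (auto simp: fin)
  also have "(\<Sum>u\<in>?S. \<Sum>v\<in>?S. (c u + d u) / 2 * ((c v + d v) / 2) * \<kappa> u v) =
      kernel_form \<kappa> (\<lambda>u. (c u + d u) / 2) (\<lambda>u. (c u + d u) / 2)"
    by (subst eq) (use S in \<open>auto simp: fin\<close>)
  finally show ?thesis .
qed

lemma shift_support: "{v. c (v - u) \<noteq> 0} = (\<lambda>v. v + u) ` {v. c v \<noteq> 0}"
  for c :: "'i::ab_group_add \<Rightarrow> real"
proof (intro set_eqI iffI)
  fix v assume "v \<in> {v. c (v - u) \<noteq> 0}"
  then show "v \<in> (\<lambda>v. v + u) ` {v. c v \<noteq> 0}" by (intro image_eqI[of _ _ "v - u"]) auto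
qed auto

lemma kernel_form_shift:
  fixes c d :: "'i::ab_group_add \<Rightarrow> real"
  assumes "\<And>u v x. \<kappa> (u + x) (v + x) = \<kappa> u v"
  shows "kernel_form \<kappa> (\<lambda>v. c (v - x)) (\<lambda>v. d (v - x)) = kernel_form \<kappa> c d"
  by (simp add: kernel_form_def shift_support sum.reindex assms)

section \<open>Finitely supported probability weights on a strip\<close>

definition strip_weights :: "real \<Rightarrow> real \<Rightarrow> (int \<times> int \<Rightarrow> real) set" where
  "strip_weights \<beta> t = {w. finite {u. w u \<noteq> 0} \<and> {u. w u \<noteq> 0} \<subseteq> strip \<beta> t \<and>
     (\<forall>u. 0 \<le> w u) \<and> (\<Sum>u | w u \<noteq> 0. w u) = 1}"

lemma strip_weights_finite: "w \<in> strip_weights \<beta> t \<Longrightarrow> finite {u. w u \<noteq> 0}"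
  by (simp add: strip_weights_def)

lemma strip_weights_nonneg: "w \<in> strip_weights \<beta> t \<Longrightarrow> 0 \<le> w u"
  unfolding strip_weights_def by blast

lemma strip_weights_sum:
  assumes "w \<in> strip_weights \<beta> t" "finite S" "\<And>u. w u \<noteq> 0 \<Longrightarrow> u \<in> S"
  shows "(\<Sum>u\<in>S. w u) = 1"
proof -
  have "(\<Sum>u\<in>S. w u) = (\<Sum>u | w u \<noteq> 0. w u)"
    by (rule sum.mono_neutral_right) (use assms in auto)
  then show ?thesis using assms(1) by (simp add: strip_weights_def)
qed

lemma strip_weights_mono: "s \<le> t \<Longrightarrow> strip_weights \<beta> s \<subseteq> strip_weights \<beta> t"
  using strip_mono[of s t \<beta>] by (auto simp: strip_weights_def)

lemma strip_weights_midpoint: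
  assumes c: "c \<in> strip_weights \<beta> t" and d: "d \<in> strip_weights \<beta> t"
  shows "(\<lambda>u. (c u + d u) / 2) \<in> strip_weights \<beta> t"
proof -
  let ?S = "{u. c u \<noteq> 0} \<union> {u. d u \<noteq> 0}"
  have nn: "0 \<le> c u" "0 \<le> d u" for u using strip_weights_nonneg c d by blast+
  \<comment> \<open>Nonnegativity excludes cancellation, so the support of the midpoint is exactly
    the union.\<close>
  have supp: "{u. (c u + d u) / 2 \<noteq> 0} = ?S"
    using nn by (auto simp: add_nonneg_eq_0_iff)
  have fin: "finite ?S" using c d by (simp add: strip_weights_def)
  have "(\<Sum>u\<in>?S. (c u + d u) / 2) = ((\<Sum>u\<in>?S. c u) + (\<Sum>u\<in>?S. d u)) / 2"
    by (simp add: sum.distrib sum_divide_distrib[symmetric])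
  also have "\<dots> = 1"
    using strip_weights_sum[OF c fin] strip_weights_sum[OF d fin] by simp
  finally show ?thesis
    using fin nn c d unfolding strip_weights_def mem_Collect_eq supp by simp
qed

lemma strip_weights_shift:
  assumes c: "c \<in> strip_weights \<beta> t" and x: "x \<in> strip \<beta> s"
  shows "(\<lambda>u. c (u - x)) \<in> strip_weights \<beta> (t + s)"
proof -
  have "(\<lambda>v. v + x) ` {v. c v \<noteq> 0} \<subseteq> strip \<beta> (t + s)"
    using c x by (auto simp: strip_weights_def intro!: strip_add)
  moreover have "0 \<le> c (u - x)" for u using strip_weights_nonneg[OF c] .
  ultimately show ?thesis
    using c unfolding strip_weights_def mem_Collect_eq shift_support
    by (simp add: sum.reindex del: split_paired_All)
qed

text \<open>The infimum of the form over weights on the strip of width \<open>t\<close> decreases in \<open>t\<close>. At a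
  continuity point of this function a small shift of an almost minimizing weight is again almost
  minimizing, so the parallelogram law makes the two close.\<close>

lemma minimizing_strip_weights:
  fixes \<kappa> :: "int \<times> int \<Rightarrow> int \<times> int \<Rightarrow> real"
  assumes inv: "\<And>u v x. \<kappa> (u + x) (v + x) = \<kappa> u v"
    and psd: "\<And>c. finite {u. c u \<noteq> 0} \<Longrightarrow> 0 \<le> kernel_form \<kappa> c c"
  obtains t and w :: "nat \<Rightarrow> int \<times> int \<Rightarrow> real" where "t > 0" "\<And>j. w j \<in> strip_weights \<beta> t"
    "\<And>e. e > 0 \<Longrightarrow> \<exists>N. \<forall>i\<ge>N. \<forall>j\<ge>N. kernel_form \<kappa> (\<lambda>u. w i u - w j u) (\<lambda>u. w i u - w j u) < e"
    "\<And>e. e > 0 \<Longrightarrow> \<exists>d>0. \<exists>N. \<forall>j\<ge>N. \<forall>x\<in>strip \<beta> d.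
        kernel_form \<kappa> (\<lambda>u. w j (u - x) - w j u) (\<lambda>u. w j (u - x) - w j u) < e"
proof -
  define D where "D t = Inf ((\<lambda>w. kernel_form \<kappa> w w) ` strip_weights \<beta> t)" for t
  have bdd: "bdd_below ((\<lambda>w. kernel_form \<kappa> w w) ` strip_weights \<beta> t)" for t
    by (rule bdd_belowI2[of _ 0]) (auto intro: psd strip_weights_finite)
  have D_le: "D t \<le> kernel_form \<kappa> w w" if "w \<in> strip_weights \<beta> t" for t w
    unfolding D_def by (rule cINF_lower[OF bdd that])
  have ne: "strip_weights \<beta> t \<noteq> {}" if "t > 0" for t
  proof -
    have "{u. (if u = 0 then 1 else 0 :: real) \<noteq> 0} = {0 :: int \<times> int}" by auto
    then have "(\<lambda>u. if u = 0 then 1 else 0) \<in> strip_weights \<beta> t"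
      unfolding strip_weights_def using that zero_in_strip[of t \<beta>] by simp
    then show ?thesis by blast
  qed
  \<comment> \<open>\<open>D\<close> decreases; its negative is a monotone function and has only
    countably many discontinuities.\<close>
  have "mono_on {0<..} (\<lambda>t. - D t)"
  proof (rule mono_onI)
    fix r s :: real assume "r \<in> {0<..}" "s \<in> {0<..}" "r \<le> s"
    then have "D s \<le> D r"
      unfolding D_def by (intro cInf_superset_mono image_mono strip_weights_mono bdd) (simp add: ne)
    then show "- D r \<le> - D s" by simp
  qed
  then have "countable {t \<in> {0<..}. \<not> isCont (\<lambda>t. - D t) t}"
    by (intro mono_on_ctble_discont_open) auto
  moreover have "uncountable {1<..<2::real}" by (simp add: uncountable_open_interval)
  ultimately have "\<not> {1<..<2} \<subseteq> {t \<in> {0<..}. \<not> isCont (\<lambda>t. - D t) t}"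
    using countable_subset by blast
  then obtain t where t: "t > 0" "isCont (\<lambda>t. - D t) t" by fastforce
  have "\<exists>w. w \<in> strip_weights \<beta> t \<and> kernel_form \<kappa> w w < D t + 1 / (real j + 1)" for j :: nat
    using cInf_lessD[of "(\<lambda>w. kernel_form \<kappa> w w) ` strip_weights \<beta> t" "D t + 1 / (real j + 1)"] ne[OF t(1)]
    by (auto simp: D_def)
  then obtain w where w: "\<And>j. w j \<in> strip_weights \<beta> t"
    "\<And>j. kernel_form \<kappa> (w j) (w j) < D t + 1 / (real j + 1)" by metis
  have small: "\<exists>N. \<forall>j\<ge>N. 1 / (real j + 1) < e" if e: "e > 0" for e :: real
  proof -
    obtain N :: nat where N: "N > 0" "1 / real N < e"
      using e real_arch_inverse[of e] by (auto simp: inverse_eq_divide)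
    have "1 / (real j + 1) \<le> 1 / real N" if "j \<ge> N" for j
      using that N by (intro divide_left_mono) auto
    with N show ?thesis by (meson le_less_trans)
  qed
  show ?thesis
  proof (rule that[of t w])
    fix e :: real assume e: "e > 0"
    \<comment> \<open>Both forms are below \<open>D t + e/4\<close> and that of the midpoint is at
      least \<open>D t\<close>, so the parallelogram law leaves less than
      \<open>4 * (e/4)\<close>.\<close>
    obtain N where N: "\<And>j. j \<ge> N \<Longrightarrow> 1 / (real j + 1) < e / 4" using small[of "e/4"] e by auto
    have "kernel_form \<kappa> (\<lambda>u. w i u - w j u) (\<lambda>u. w i u - w j u) < e" if "i \<ge> N" "j \<ge> N" for i j
      using kernel_form_parallelogram[OF strip_weights_finite[OF w(1)] strip_weights_finite[OF w(1)], of \<kappa> i j]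
        D_le[OF strip_weights_midpoint[OF w(1) w(1)], of i j] w(2)[of i] w(2)[of j] N[of i] N[of j] that
      by linarith
    then show "\<exists>N. \<forall>i\<ge>N. \<forall>j\<ge>N. kernel_form \<kappa> (\<lambda>u. w i u - w j u) (\<lambda>u. w i u - w j u) < e" by blast
  next
    fix e :: real assume e: "e > 0"
    \<comment> \<open>A shift keeps the value of the form, and the midpoint with the shifted weight
      lives on width \<open>t + d/2\<close>, where the infimum exceeds \<open>D t - e/8\<close>. The
      parallelogram law thus leaves less than \<open>4 * (e/8) + 4 * (e/8)\<close>.\<close>
    obtain N where N: "\<And>j. j \<ge> N \<Longrightarrow> 1 / (real j + 1) < e / 8" using small[of "e/8"] e by auto
    obtain d where d: "d > 0" "\<And>s. \<bar>s - t\<bar> < d \<Longrightarrow> \<bar>D s - D t\<bar> < e / 8"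
    proof -
      obtain d where d: "d > 0" "\<And>s. dist s t < d \<Longrightarrow> dist (- D s) (- D t) < e / 8"
        using t(2) e unfolding continuous_at_eps_delta by (metis divide_pos_pos zero_less_numeral)
      have "\<bar>D s - D t\<bar> < e / 8" if "\<bar>s - t\<bar> < d" for s
        using d(2)[of s] that by (simp add: dist_real_def abs_minus_commute)
      with d(1) show ?thesis by (rule that)
    qed
    have "kernel_form \<kappa> (\<lambda>u. w j (u - x) - w j u) (\<lambda>u. w j (u - x) - w j u) < e"
      if j: "j \<ge> N" and x: "x \<in> strip \<beta> (d/2)" for j x
    proof -
      have sh: "(\<lambda>u. w j (u - x)) \<in> strip_weights \<beta> (t + d/2)"
        by (rule strip_weights_shift[OF w(1) x])
      have wj: "w j \<in> strip_weights \<beta> (t + d/2)" using w(1) strip_weights_mono[of t "t + d/2" \<beta>] d by auto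
      have "\<bar>D (t + d/2) - D t\<bar> < e / 8" using d by simp
      then show ?thesis
        using kernel_form_parallelogram[OF strip_weights_finite[OF sh] strip_weights_finite[OF wj], of \<kappa>]
          D_le[OF strip_weights_midpoint[OF sh wj]] w(2)[of j] N[OF j]
          kernel_form_shift[of \<kappa> "w j" x "w j", OF inv]
        by linarith
    qed
    then show "\<exists>d>0. \<exists>N. \<forall>j\<ge>N. \<forall>x\<in>strip \<beta> d.
        kernel_form \<kappa> (\<lambda>u. w j (u - x) - w j u) (\<lambda>u. w j (u - x) - w j u) < e"
      using half_gt_zero[OF d(1)] by blast
  qed (use t w in auto)
qed

subsection \<open>The Koopman representation and directional almost periodicity\<close>

text \<open>For the indicator of a measurable set this is membership in
  \<open>kronecker_sets\<close>, see \<open>kronecker_sets_iff\<close>; as a property of functions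
  it is stable under sums, Lipschitz maps and limits.\<close>

definition almost_periodic ::
  "'a measure \<Rightarrow> (int \<times> int \<Rightarrow> 'a \<Rightarrow> 'a) \<Rightarrow> real \<Rightarrow> real \<Rightarrow> ('a \<Rightarrow> complex) \<Rightarrow> bool" where
  "almost_periodic M T \<beta> c f \<longleftrightarrow>
     f \<in> L2_fun M \<and> L2_totally_bounded M ((\<lambda>v. koopman T v f) ` strip \<beta> c)"

lemma koopman_apply: "koopman T v f x = f (T v x)"
  by (simp add: koopman_def)

lemma koopman_pointwise:
  "koopman T v (\<lambda>x. f x - g x) = (\<lambda>x. koopman T v f x - koopman T v g x)"
  "koopman T v (\<lambda>x. f x + g x) = (\<lambda>x. koopman T v f x + koopman T v g x)"
  "koopman T v (\<lambda>x. \<phi> (f x)) = (\<lambda>x. \<phi> (koopman T v f x))"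
  by (simp_all add: koopman_def comp_def)

context z2_mps
begin

lemma space_eq_UNIV: "space M = UNIV"
  using sets_eq_imp_space_eq[OF sets_borel] by simp

lemma T_measurable: "T v \<in> measurable M M"
proof -
  obtain S where "homeomorphism UNIV UNIV (T v) S" using homeo by blast
  then have "continuous_on UNIV (T v)" by (simp add: homeomorphism_def)
  then have "T v \<in> borel_measurable borel" by (rule borel_measurable_continuous_onI)
  then show ?thesis using measurable_cong_sets[OF sets_borel sets_borel] by blast
qed

text \<open>Additivity makes \<open>T 0\<close> idempotent, and an injective idempotent map is the
  identity.\<close>

lemma T_zero: "T 0 x = x"
proof -
  obtain S where S: "homeomorphism UNIV UNIV (T 0) S" using homeo by blast
  have "T 0 (T 0 x) = T 0 x" using hom[of 0 0] by (metis add.right_neutral comp_apply)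
  then show ?thesis using S by (metis UNIV_I homeomorphism_apply1)
qed

lemma koopman_zero: "koopman T 0 f = f"
  by (simp add: koopman_def comp_def T_zero)

lemma koopman_koopman: "koopman T u (koopman T v f) = koopman T (v + u) f"
  by (simp add: koopman_def hom comp_assoc)

lemma koopman_L2:
  assumes "f \<in> L2_fun M"
  shows "koopman T v f \<in> L2_fun M"
proof (rule L2_funI)
  have [measurable]: "f \<in> borel_measurable M" using assms by (rule L2_fun_measurable)
  show "koopman T v f \<in> borel_measurable M"
    unfolding koopman_def by (rule measurable_comp[OF T_measurable]) simp
  have "integrable (distr M M (T v)) (\<lambda>x. (cmod (f x))\<^sup>2)"
    using assms by (simp add: invariant L2_fun_integrable)
  then show "integrable M (\<lambda>x. (cmod (koopman T v f x))\<^sup>2)"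
    by (subst (asm) integrable_distr_eq) (auto simp: T_measurable koopman_apply)
qed

lemma L2_norm_koopman:
  assumes "f \<in> L2_fun M"
  shows "L2_norm M (koopman T v f) = L2_norm M f"
proof -
  have [measurable]: "f \<in> borel_measurable M" using assms by (rule L2_fun_measurable)
  have "(\<integral>x. (cmod (f x))\<^sup>2 \<partial>distr M M (T v)) = (\<integral>x. (cmod (f (T v x)))\<^sup>2 \<partial>M)"
    by (rule integral_distr) (auto simp: T_measurable)
  then show ?thesis by (simp add: L2_norm_def koopman_apply invariant)
qed

lemma L2_inner_koopman:
  assumes "f \<in> L2_fun M" "g \<in> L2_fun M"
  shows "L2_inner M (koopman T v f) (koopman T v g) = L2_inner M f g"
proof -
  have [measurable]: "f \<in> borel_measurable M" "g \<in> borel_measurable M"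
    using assms by (auto intro: L2_fun_measurable)
  have "(\<integral>x. f x * cnj (g x) \<partial>distr M M (T v)) = (\<integral>x. f (T v x) * cnj (g (T v x)) \<partial>M)"
    by (rule integral_distr) (auto simp: T_measurable)
  then show ?thesis by (simp add: L2_inner_def koopman_apply invariant)
qed

lemma L2_inner_koopman_left:
  assumes "f \<in> L2_fun M" "g \<in> L2_fun M"
  shows "L2_inner M (koopman T v f) g = L2_inner M f (koopman T (- v) g)"
  using L2_inner_koopman[OF assms(1) koopman_L2[OF assms(2)], of v "- v"]
  by (simp add: koopman_koopman koopman_zero)

lemma almost_periodic_orbit:
  "almost_periodic M T \<beta> c f \<Longrightarrow> (\<lambda>v. koopman T v f) ` strip \<beta> c \<subseteq> L2_fun M"
  by (auto simp: almost_periodic_def intro: koopman_L2)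

text \<open>Applying \<open>\<phi>\<close> pointwise commutes with \<open>koopman T v\<close> and
  stretches distances by at most \<open>L\<close>. Truncations of this kind take the place of
  products, under which square integrability may be lost.\<close>

lemma almost_periodic_Lipschitz:
  assumes f: "almost_periodic M T \<beta> c f" and lip: "\<And>z w. cmod (\<phi> z - \<phi> w) \<le> L * cmod (z - w)"
  shows "almost_periodic M T \<beta> c (\<lambda>x. \<phi> (f x))"
  using L2_totally_bounded_Lipschitz[OF almost_periodic_orbit[OF f] _ lip] f L2_fun_Lipschitz[OF _ lip]
  by (simp add: almost_periodic_def image_image koopman_pointwise(3)[of T _ \<phi>])

lemma almost_periodic_add:
  assumes f: "almost_periodic M T \<beta> c f" and g: "almost_periodic M T \<beta> c g"
  shows "almost_periodic M T \<beta> c (\<lambda>x. f x + g x)"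
  unfolding almost_periodic_def
proof
  show "(\<lambda>x. f x + g x) \<in> L2_fun M" using f g by (auto simp: almost_periodic_def intro: L2_fun_add)
  show "L2_totally_bounded M ((\<lambda>v. koopman T v (\<lambda>x. f x + g x)) ` strip \<beta> c)"
  proof (rule L2_totally_bounded_subset[OF L2_totally_bounded_add])
    show "(\<lambda>v. koopman T v (\<lambda>x. f x + g x)) ` strip \<beta> c \<subseteq> {\<lambda>x. f' x + g' x | f' g'.
       f' \<in> (\<lambda>v. koopman T v f) ` strip \<beta> c \<and> g' \<in> (\<lambda>v. koopman T v g) ` strip \<beta> c}"
      unfolding koopman_pointwise by blast
  qed (use f g almost_periodic_orbit[OF f] almost_periodic_orbit[OF g] in \<open>simp_all add: almost_periodic_def\<close>)
qed

lemma almost_periodic_const: "almost_periodic M T \<beta> c (\<lambda>x. a)"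
  unfolding almost_periodic_def L2_totally_bounded_def
  by (auto intro!: L2_fun_const exI[of _ "{\<lambda>x. a}"] simp: koopman_apply)

text \<open>\<open>koopman T v\<close> preserves the norm, so one approximation of \<open>f\<close>
  serves along the whole orbit.\<close>

lemma almost_periodic_approx:
  assumes f: "f \<in> L2_fun M"
    and "\<And>e. e > 0 \<Longrightarrow> \<exists>g. almost_periodic M T \<beta> c g \<and> L2_norm M (\<lambda>x. f x - g x) \<le> e"
  shows "almost_periodic M T \<beta> c f"
  unfolding almost_periodic_def
proof (intro conjI f L2_totally_bounded_approx)
  show "(\<lambda>v. koopman T v f) ` strip \<beta> c \<subseteq> L2_fun M" using f by (auto intro: koopman_L2)
  fix e :: real assume "e > 0"
  then obtain g where g: "almost_periodic M T \<beta> c g" "L2_norm M (\<lambda>x. f x - g x) \<le> e"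
    using assms(2) by blast
  have "g \<in> L2_fun M" using g by (simp add: almost_periodic_def)
  then have "L2_norm M (\<lambda>x. koopman T v f x - koopman T v g x) \<le> e" for v
    using L2_norm_koopman[OF L2_fun_diff[OF f], of g v] g(2) by (simp add: koopman_pointwise)
  then show "\<exists>G\<subseteq>L2_fun M. L2_totally_bounded M G \<and>
      (\<forall>f'\<in>(\<lambda>v. koopman T v f) ` strip \<beta> c. \<exists>g\<in>G. L2_norm M (\<lambda>x. f' x - g x) \<le> e)"
    using g(1) almost_periodic_orbit[OF g(1)]
    by (intro exI[of _ "(\<lambda>v. koopman T v g) ` strip \<beta> c"]) (auto simp: almost_periodic_def)
qed

lemma L2_totally_bounded_koopman:
  assumes F: "F \<subseteq> L2_fun M" "L2_totally_bounded M F"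
  shows "L2_totally_bounded M (koopman T u ` F)"
  unfolding L2_totally_bounded_def
proof (intro allI impI)
  fix e :: real assume "e > 0"
  then obtain S where S: "finite S" "S \<subseteq> L2_fun M"
    "\<And>f. f \<in> F \<Longrightarrow> \<exists>s\<in>S. L2_norm M (\<lambda>x. f x - s x) < e"
    using F(2) unfolding L2_totally_bounded_def by metis
  have "\<exists>s\<in>S. L2_norm M (\<lambda>x. koopman T u f x - koopman T u s x) < e" if f: "f \<in> F" for f
  proof -
    obtain s where s: "s \<in> S" "L2_norm M (\<lambda>x. f x - s x) < e" using S(3)[OF f] by blast
    have "L2_norm M (\<lambda>x. koopman T u f x - koopman T u s x) = L2_norm M (\<lambda>x. f x - s x)"
      using L2_norm_koopman[OF L2_fun_diff[of f M s], of u] f s F S by (auto simp: koopman_pointwise)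
    with s(2) show ?thesis by (intro bexI[OF _ s(1)]) simp
  qed
  then show "\<exists>S. finite S \<and> S \<subseteq> L2_fun M \<and>
      (\<forall>f\<in>koopman T u ` F. \<exists>s\<in>S. L2_norm M (\<lambda>x. f x - s x) < e)"
    using S(1,2) by (intro exI[of _ "koopman T u ` S"]) (auto intro: koopman_L2)
qed

lemma almost_periodic_koopman:
  assumes f: "almost_periodic M T \<beta> c f"
  shows "almost_periodic M T \<beta> c (koopman T u f)"
proof -
  have "(\<lambda>v. koopman T v (koopman T u f)) ` strip \<beta> c = koopman T u ` (\<lambda>v. koopman T v f) ` strip \<beta> c"
    by (simp add: image_image koopman_koopman add.commute)
  then show ?thesis
    using L2_totally_bounded_koopman[OF almost_periodic_orbit[OF f], of u] f
    by (simp add: almost_periodic_def koopman_L2)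
qed

text \<open>A strip of any width is covered by finitely many translates of the strip of width
  \<open>c\<close>, so the orbit over it lies in finitely many isometric images of the given orbit.
  This is why the Kronecker algebra does not depend on the width.\<close>

lemma almost_periodic_width:
  assumes irr: "\<beta> \<notin> \<rat>" and c: "c > 0" and f: "almost_periodic M T \<beta> c f"
  shows "almost_periodic M T \<beta> b f"
proof -
  obtain V where V: "finite V" "\<And>v. v \<in> strip \<beta> b \<Longrightarrow> \<exists>u\<in>V. v - u \<in> strip \<beta> c"
    using strip_finite_cover[OF irr c, of b] by metis
  have "(\<lambda>v. koopman T v f) ` strip \<beta> b \<subseteq> (\<Union>u\<in>V. koopman T u ` (\<lambda>v. koopman T v f) ` strip \<beta> c)"
  proof (rule image_subsetI)
    fix v assume "v \<in> strip \<beta> b"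
    then obtain u where u: "u \<in> V" "v - u \<in> strip \<beta> c" using V(2) by blast
    have "koopman T v f = koopman T u (koopman T (v - u) f)" by (simp add: koopman_koopman)
    with u show "koopman T v f \<in> (\<Union>u\<in>V. koopman T u ` (\<lambda>v. koopman T v f) ` strip \<beta> c)" by blast
  qed
  moreover have "L2_totally_bounded M (\<Union>u\<in>V. koopman T u ` (\<lambda>v. koopman T v f) ` strip \<beta> c)"
    using V(1) f almost_periodic_orbit[OF f]
    by (intro L2_totally_bounded_UN L2_totally_bounded_koopman) (auto simp: almost_periodic_def)
  ultimately show ?thesis
    using f L2_totally_bounded_subset by (auto simp: almost_periodic_def)
qed

subsection \<open>The directional Kronecker algebra\<close>

lemma kronecker_sets_iff:
  "B \<in> kronecker_sets M T \<beta> c \<longleftrightarrow> B \<in> sets M \<and> almost_periodic M T \<beta> c (indicator B)"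
proof (cases "B \<in> sets M")
  case True
  have "(\<lambda>v. koopman T v (indicator B)) ` strip \<beta> c \<subseteq> L2_fun M"
    using True by (auto intro: koopman_L2 L2_fun_indicator)
  from L2_compact_closure_iff[OF this] True show ?thesis
    by (simp add: kronecker_sets_def almost_periodic_def L2_fun_indicator image_image)
qed (simp add: kronecker_sets_def)

text \<open>Applied to the sum of two indicators, the 1-Lipschitz truncation
  \<open>max 0 (Re z - 1)\<close> yields the indicator of the intersection.\<close>

lemma Int_stable_kronecker_sets: "Int_stable (kronecker_sets M T \<beta> c)"
proof (rule Int_stableI)
  fix A B assume AB: "A \<in> kronecker_sets M T \<beta> c" "B \<in> kronecker_sets M T \<beta> c"
  define \<phi> where "\<phi> z = complex_of_real (max 0 (Re z - 1))" for z
  have lip: "cmod (\<phi> z - \<phi> w) \<le> 1 * cmod (z - w)" for z w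
  proof -
    have "\<bar>max 0 (Re z - 1) - max 0 (Re w - 1)\<bar> \<le> \<bar>Re (z - w)\<bar>" by (simp add: max_def)
    also have "\<dots> \<le> cmod (z - w)" by (rule abs_Re_le_cmod)
    finally show ?thesis by (simp add: \<phi>_def norm_of_real flip: of_real_diff)
  qed
  have "almost_periodic M T \<beta> c (\<lambda>x. \<phi> (indicator A x + indicator B x))"
    using AB by (intro almost_periodic_Lipschitz[OF _ lip] almost_periodic_add)
      (simp_all add: kronecker_sets_iff)
  also have "(\<lambda>x. \<phi> (indicator A x + indicator B x)) = indicator (A \<inter> B)"
    by (rule ext) (simp add: \<phi>_def indicator_def)
  finally show "A \<inter> B \<in> kronecker_sets M T \<beta> c"
    using AB by (simp add: kronecker_sets_iff sets.Int)
qed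

lemma space_in_kronecker_sets: "space M \<in> kronecker_sets M T \<beta> c"
proof -
  have "indicator (space M) = (\<lambda>x. 1 :: complex)" by (simp add: space_eq_UNIV fun_eq_iff)
  then show ?thesis by (simp add: kronecker_sets_iff almost_periodic_const)
qed

lemma kronecker_sets_subset: "kronecker_sets M T \<beta> c \<subseteq> Pow (space M)"
  by (simp add: space_eq_UNIV)

lemma sets_kronecker_algebra:
  "sets (kronecker_algebra M T \<beta> c) = sigma_sets (space M) (kronecker_sets M T \<beta> c)"
  by (simp add: kronecker_algebra_def kronecker_sets_subset)

lemma space_kronecker_algebra: "space (kronecker_algebra M T \<beta> c) = space M"
  by (simp add: kronecker_algebra_def kronecker_sets_subset)

text \<open>The indicator is the L2 limit of the ramps \<open>\<phi> n (h x)\<close>, which are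
  Lipschitz functions of \<open>h\<close>. With the strict inequality the ramps converge at every
  point, also where \<open>\<psi> (h x) = a\<close>, so every level \<open>a\<close> is
  admissible.\<close>

lemma superlevel_in_kronecker_sets:
  fixes \<psi> :: "complex \<Rightarrow> real"
  assumes h: "almost_periodic M T \<beta> c h" and \<psi>: "\<And>z w. \<bar>\<psi> z - \<psi> w\<bar> \<le> cmod (z - w)"
  shows "{x. a < \<psi> (h x)} \<in> kronecker_sets M T \<beta> c"
proof -
  define \<phi> where "\<phi> n z = complex_of_real (min 1 (max 0 (real n * (\<psi> z - a))))" for n z
  have lip: "cmod (\<phi> n z - \<phi> n w) \<le> real n * cmod (z - w)" for n z w
  proof -
    have "cmod (\<phi> n z - \<phi> n w) \<le> \<bar>real n * (\<psi> z - a) - real n * (\<psi> w - a)\<bar>"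
      by (simp add: \<phi>_def norm_of_real min_def max_def flip: of_real_diff)
    also have "\<dots> = real n * \<bar>\<psi> z - \<psi> w\<bar>"
      by (simp add: abs_mult flip: right_diff_distrib)
    also have "\<dots> \<le> real n * cmod (z - w)" using \<psi> by (intro mult_left_mono) auto
    finally show ?thesis .
  qed
  have hL2: "h \<in> L2_fun M" using h by (simp add: almost_periodic_def)
  have [measurable]: "h \<in> borel_measurable M" using hL2 by (rule L2_fun_measurable)
  have "1-lipschitz_on UNIV \<psi>"
    by (rule lipschitz_onI) (use \<psi> in \<open>auto simp: dist_norm\<close>)
  then have [measurable]: "\<psi> \<in> borel_measurable borel"
    by (intro borel_measurable_continuous_onI lipschitz_on_continuous_on)
  let ?B = "{x. a < \<psi> (h x)}"
  have "{x \<in> space M. a < \<psi> (h x)} \<in> sets M" by measurable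
  then have B: "?B \<in> sets M" by (simp add: space_eq_UNIV)
  have ap: "almost_periodic M T \<beta> c (\<lambda>x. \<phi> n (h x))" for n
    by (rule almost_periodic_Lipschitz[OF h lip])
  then have [measurable]: "(\<lambda>x. \<phi> n (h x)) \<in> borel_measurable M" for n
    by (auto simp: almost_periodic_def dest: L2_fun_measurable)
  have "(\<lambda>n. \<integral>x. (cmod (indicator ?B x - \<phi> n (h x)))\<^sup>2 \<partial>M) \<longlonglongrightarrow> (\<integral>x. 0 \<partial>M)"
  proof (rule integral_dominated_convergence[where w = "\<lambda>x. 1"])
    show "AE x in M. (\<lambda>n. (cmod (indicator ?B x - \<phi> n (h x)))\<^sup>2) \<longlonglongrightarrow> 0"
    proof (rule AE_I2)
      fix x
      have "eventually (\<lambda>n. \<phi> n (h x) = indicator ?B x) sequentially"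
      proof (cases "a < \<psi> (h x)")
        case True
        then obtain N :: nat where N: "1 / (\<psi> (h x) - a) \<le> real N"
          using real_arch_simple by blast
        have "\<phi> n (h x) = 1" if "n \<ge> N" for n
        proof -
          have "1 / (\<psi> (h x) - a) \<le> real n" using N that by linarith
          then have "1 \<le> real n * (\<psi> (h x) - a)" using True by (simp add: field_simps)
          then show ?thesis by (simp add: \<phi>_def)
        qed
        then show ?thesis using True by (auto simp: eventually_sequentially)
      next
        case False
        then have "real n * (\<psi> (h x) - a) \<le> 0" for n by (intro mult_nonneg_nonpos) auto
        then show ?thesis using False by (simp add: \<phi>_def max_absorb1)
      qed
      then have "eventually (\<lambda>n. (cmod (indicator ?B x - \<phi> n (h x)))\<^sup>2 = 0) sequentially"
        by eventually_elim simp
      then show "(\<lambda>n. (cmod (indicator ?B x - \<phi> n (h x)))\<^sup>2) \<longlonglongrightarrow> 0" by (rule tendsto_eventually)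
    qed
    fix n
    have "cmod (indicator ?B x - \<phi> n (h x)) \<le> 1" for x
    proof -
      define r where "r = min 1 (max 0 (real n * (\<psi> (h x) - a)))"
      have "0 \<le> r" "r \<le> 1" by (simp_all add: r_def)
      then have "\<bar>indicator ?B x - r\<bar> \<le> 1" by (simp add: indicator_def)
      moreover have "indicator ?B x - \<phi> n (h x) = complex_of_real (indicator ?B x - r)"
        by (simp add: \<phi>_def r_def indicator_def)
      ultimately show ?thesis by (simp only: norm_of_real)
    qed
    then show "AE x in M. norm ((cmod (indicator ?B x - \<phi> n (h x)))\<^sup>2) \<le> 1"
      by (auto simp: power_le_one)
  qed (use B in measurable)
  then have "(\<lambda>n. sqrt (\<integral>x. (cmod (indicator ?B x - \<phi> n (h x)))\<^sup>2 \<partial>M)) \<longlonglongrightarrow> sqrt 0"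
    by (intro tendsto_real_sqrt) simp
  then have lim: "(\<lambda>n. L2_norm M (\<lambda>x. indicator ?B x - \<phi> n (h x))) \<longlonglongrightarrow> 0"
    by (simp add: L2_norm_def)
  have "almost_periodic M T \<beta> c (indicator ?B)"
  proof (rule almost_periodic_approx[OF L2_fun_indicator[OF B]])
    fix e :: real assume "e > 0"
    then have "eventually (\<lambda>n. L2_norm M (\<lambda>x. indicator ?B x - \<phi> n (h x)) < e) sequentially"
      using lim by (auto dest: order_tendstoD(2))
    then show "\<exists>g. almost_periodic M T \<beta> c g \<and> L2_norm M (\<lambda>x. indicator ?B x - g x) \<le> e"
      using ap by (auto simp: eventually_sequentially intro: less_imp_le)
  qed
  with B show ?thesis by (simp add: kronecker_sets_iff)
qed

lemma almost_periodic_measurable: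
  assumes h: "almost_periodic M T \<beta> c h" and \<psi>: "\<And>z w. \<bar>\<psi> z - \<psi> w\<bar> \<le> cmod (z - w)"
  shows "(\<lambda>x. \<psi> (h x) :: real) \<in> borel_measurable (kronecker_algebra M T \<beta> c)"
  unfolding borel_measurable_iff_greater
  using superlevel_in_kronecker_sets[OF h \<psi>]
  by (auto simp: space_kronecker_algebra sets_kronecker_algebra space_eq_UNIV)

lemma sigma_finite_subalgebra_kronecker: "sigma_finite_subalgebra M (kronecker_algebra M T \<beta> c)"
  by (rule finite_measure_subalgebra_is_sigma_finite)
     (simp add: finite_measure_subalgebra_def finite_measure_subalgebra_axioms_def
       subalgebra_kronecker finite_measure_axioms)

section \<open>Weak mixing as orthogonality to the Kronecker algebra\<close>

lemma Re_Im_L2: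
  assumes "f \<in> L2_fun M"
  shows "(\<lambda>x. complex_of_real (Re (f x))) \<in> L2_fun M" "(\<lambda>x. complex_of_real (Im (f x))) \<in> L2_fun M"
proof -
  have [measurable]: "f \<in> borel_measurable M" using assms by (rule L2_fun_measurable)
  show "(\<lambda>x. complex_of_real (Re (f x))) \<in> L2_fun M" "(\<lambda>x. complex_of_real (Im (f x))) \<in> L2_fun M"
    by (rule L2_fun_dominated[OF _ assms]; simp add: abs_Re_le_cmod abs_Im_le_cmod)+
qed

text \<open>The real and imaginary parts of \<open>h\<close> are measurable for the algebra, so in
  each integral the part of \<open>f\<close> may be replaced by its conditional expectation, which
  is 0. Four such real integrals make up the inner product.\<close>

lemma WM_orthogonal:
  assumes f: "f \<in> WM M T \<beta> c" and h: "almost_periodic M T \<beta> c h"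
  shows "L2_inner M f h = 0"
proof -
  interpret sigma_finite_subalgebra M "kronecker_algebra M T \<beta> c"
    by (rule sigma_finite_subalgebra_kronecker)
  have fL2: "f \<in> L2_fun M" and hL2: "h \<in> L2_fun M"
    using f h by (simp_all add: WM_def almost_periodic_def)
  have [measurable]: "f \<in> borel_measurable M" using fL2 by (rule L2_fun_measurable)
  have ce: "AE x in M. real_cond_exp M (kronecker_algebra M T \<beta> c) (\<lambda>y. Re (f y)) x = 0"
    "AE x in M. real_cond_exp M (kronecker_algebra M T \<beta> c) (\<lambda>y. Im (f y)) x = 0"
    using f by (auto simp: WM_def complex_cond_exp_def complex_eq_iff elim: eventually_mono)
  have prod: "integrable M (\<lambda>x. p x * q x)"
    if "(\<lambda>x. complex_of_real (p x)) \<in> L2_fun M" "(\<lambda>x. complex_of_real (q x)) \<in> L2_fun M" for p q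
    using L2_mult_cnj_integrable[OF that]
    by (simp add: complex_of_real_integrable_eq flip: of_real_mult)
  have orth: "(\<integral>x. p x * q x \<partial>M) = 0"
    if p: "p \<in> borel_measurable (kronecker_algebra M T \<beta> c)" "(\<lambda>x. complex_of_real (p x)) \<in> L2_fun M"
      and q: "(\<lambda>x. complex_of_real (q x)) \<in> L2_fun M" "q \<in> borel_measurable M"
        "AE x in M. real_cond_exp M (kronecker_algebra M T \<beta> c) q x = 0" for p q :: "'a \<Rightarrow> real"
  proof -
    have "(\<integral>x. p x * q x \<partial>M) = (\<integral>x. p x * real_cond_exp M (kronecker_algebra M T \<beta> c) q x \<partial>M)"
      by (rule real_cond_exp_intg(2)[symmetric]) (use p q prod in auto)
    also have "\<dots> = (\<integral>x. 0 \<partial>M)"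
      by (rule integral_cong_AE)
         (use p(1) q(3) in \<open>auto intro: borel_measurable_times measurable_from_subalg[OF subalg]\<close>)
    finally show ?thesis by simp
  qed
  have m: "(\<lambda>x. Re (h x)) \<in> borel_measurable (kronecker_algebra M T \<beta> c)"
    "(\<lambda>x. Im (h x)) \<in> borel_measurable (kronecker_algebra M T \<beta> c)"
    by (rule almost_periodic_measurable[OF h]; simp add: abs_Re_le_cmod abs_Im_le_cmod
        flip: minus_complex.sel)+
  note R = Re_Im_L2[OF fL2] Re_Im_L2[OF hL2]
  have int: "integrable M (\<lambda>x. f x * cnj (h x))" by (rule L2_mult_cnj_integrable[OF fL2 hL2])
  have "Re (L2_inner M f h) = (\<integral>x. Re (h x) * Re (f x) + Im (h x) * Im (f x) \<partial>M)"
    unfolding L2_inner_def integral_Re[OF int, symmetric] by (simp add: mult.commute)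
  also have "\<dots> = 0" using R m ce by (simp add: prod orth)
  finally have re: "Re (L2_inner M f h) = 0" .
  have "Im (L2_inner M f h) = (\<integral>x. Re (h x) * Im (f x) - Im (h x) * Re (f x) \<partial>M)"
    unfolding L2_inner_def integral_Im[OF int, symmetric] by (simp add: mult.commute)
  also have "\<dots> = 0" using R m ce by (simp add: prod orth)
  finally show ?thesis using re by (simp add: complex_eq_iff)
qed

lemma L2_inner_indicator:
  "L2_inner M f (indicator B) = (LINT x:B|M. f x)"
  unfolding L2_inner_def set_lebesgue_integral_def
  by (rule Bochner_Integration.integral_cong) (auto simp: indicator_def)

text \<open>Testing on the generating sets suffices: they form a pi-system containing the whole
  space, so the vanishing of integrals extends to the generated algebra, and the zero function then
  meets the characterization of the conditional expectation.\<close>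

lemma WM_I:
  assumes f: "f \<in> L2_fun M" and orth: "\<And>B. B \<in> kronecker_sets M T \<beta> c \<Longrightarrow> L2_inner M f (indicator B) = 0"
  shows "f \<in> WM M T \<beta> c"
proof -
  interpret sigma_finite_subalgebra M "kronecker_algebra M T \<beta> c"
    by (rule sigma_finite_subalgebra_kronecker)
  have int: "integrable M f"
    using L2_mult_cnj_integrable[OF f L2_fun_const[of 1]] by simp
  have setint: "set_integrable M A f" if "A \<in> sets M" for A
    using that int unfolding set_integrable_def by (intro integrable_mult_indicator)
  have sub: "sigma_sets (space M) (kronecker_sets M T \<beta> c) \<subseteq> sets M"
    using subalgebra_kronecker[of \<beta> c] by (simp add: subalgebra_def sets_kronecker_algebra)
  have whole: "(LINT x:space M|M. f x) = 0"
    using orth[OF space_in_kronecker_sets] by (simp add: L2_inner_indicator)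
  have zero: "(LINT x:A|M. f x) = 0" if "A \<in> sigma_sets (space M) (kronecker_sets M T \<beta> c)" for A
    using Int_stable_kronecker_sets kronecker_sets_subset that
  proof (induction rule: sigma_sets_induct_disjoint)
    case (basic A)
    then show ?case using orth by (simp add: L2_inner_indicator)
  next
    case empty
    show ?case by (simp add: set_lebesgue_integral_def)
  next
    case (compl A)
    have A: "A \<in> sets M" using compl sub by auto
    have "(LINT x:A \<union> (space M - A)|M. f x) = (LINT x:A|M. f x) + (LINT x:space M - A|M. f x)"
      by (intro set_integral_Un setint) (use A in auto)
    moreover have "A \<union> (space M - A) = space M" using sets.sets_into_space[OF A] by blast
    ultimately show ?case using compl whole by simp
  next
    case (union A)
    have A: "A i \<in> sets M" for i using union(2) sub by auto
    have "(LINT x:(\<Union>i. A i)|M. f x) = (\<Sum>i. LINT x:A i|M. f x)"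
      by (intro lebesgue_integral_countable_add setint)
         (use A union(1) in \<open>auto simp: disjoint_family_on_def\<close>)
    then show ?case using union by simp
  qed
  have re: "(LINT x:A|M. Re (f x)) = 0" "(LINT x:A|M. Im (f x)) = 0"
    if "A \<in> sets (kronecker_algebra M T \<beta> c)" for A
  proof -
    have A: "A \<in> sigma_sets (space M) (kronecker_sets M T \<beta> c)"
      using that by (simp add: sets_kronecker_algebra)
    then have i: "integrable M (\<lambda>x. indicator A x *\<^sub>R f x)"
      using setint sub unfolding set_integrable_def by auto
    show "(LINT x:A|M. Re (f x)) = 0" "(LINT x:A|M. Im (f x)) = 0"
      using integral_Re[OF i] integral_Im[OF i] zero[OF A] by (simp_all add: set_lebesgue_integral_def)
  qed
  have "AE x in M. real_cond_exp M (kronecker_algebra M T \<beta> c) (\<lambda>y. Re (f y)) x = 0"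
    "AE x in M. real_cond_exp M (kronecker_algebra M T \<beta> c) (\<lambda>y. Im (f y)) x = 0"
    by (intro real_cond_exp_charact; use re int in \<open>simp add: set_lebesgue_integral_def\<close>)+
  then show ?thesis
    using f unfolding WM_def complex_cond_exp_def by (auto simp: complex_eq_iff)
qed

end

subsection \<open>Averaged rank-one operators along an orbit\<close>

definition orbit_operator ::
  "'a measure \<Rightarrow> (int \<times> int \<Rightarrow> 'a \<Rightarrow> 'a) \<Rightarrow> ('a \<Rightarrow> complex) \<Rightarrow> (int \<times> int \<Rightarrow> real) \<Rightarrow>
    ('a \<Rightarrow> complex) \<Rightarrow> 'a \<Rightarrow> complex" where
  "orbit_operator M T f c \<phi> x =
     (\<Sum>u | c u \<noteq> 0. (c u * L2_inner M \<phi> (koopman T u f)) * koopman T u f x)"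

text \<open>The Hilbert-Schmidt inner product of the rank-one operators attached to \<open>u\<close>
  and \<open>v\<close>. For square-integrable \<open>f\<close> it depends only on the difference of
  the indices, see \<open>orbit_kernel_shift\<close>.\<close>

definition orbit_kernel ::
  "'a measure \<Rightarrow> (int \<times> int \<Rightarrow> 'a \<Rightarrow> 'a) \<Rightarrow> ('a \<Rightarrow> complex) \<Rightarrow> int \<times> int \<Rightarrow> int \<times> int \<Rightarrow> real" where
  "orbit_kernel M T f u v = (cmod (L2_inner M (koopman T u f) (koopman T v f)))\<^sup>2"

lemma orbit_operator_eq:
  assumes "finite S" "\<And>u. c u \<noteq> 0 \<Longrightarrow> u \<in> S"
  shows "orbit_operator M T f c \<phi> x =
    (\<Sum>u\<in>S. (c u * L2_inner M \<phi> (koopman T u f)) * koopman T u f x)"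
  unfolding orbit_operator_def by (rule sum.mono_neutral_left) (use assms in auto)

lemma orbit_operator_diff:
  assumes "finite {u. c u \<noteq> 0}" "finite {u. d u \<noteq> 0}"
  shows "orbit_operator M T f (\<lambda>u. c u - d u) \<phi> x = orbit_operator M T f c \<phi> x - orbit_operator M T f d \<phi> x"
proof -
  let ?S = "{u. c u \<noteq> 0} \<union> {u. d u \<noteq> 0}"
  have "orbit_operator M T f (\<lambda>u. c u - d u) \<phi> x =
      (\<Sum>u\<in>?S. (complex_of_real (c u - d u) * L2_inner M \<phi> (koopman T u f)) * koopman T u f x)"
    by (rule orbit_operator_eq) (use assms in auto)
  also have "\<dots> = (\<Sum>u\<in>?S. (c u * L2_inner M \<phi> (koopman T u f)) * koopman T u f x)
      - (\<Sum>u\<in>?S. (d u * L2_inner M \<phi> (koopman T u f)) * koopman T u f x)"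
    by (simp add: left_diff_distrib sum_subtractf)
  also have "(\<Sum>u\<in>?S. (c u * L2_inner M \<phi> (koopman T u f)) * koopman T u f x) = orbit_operator M T f c \<phi> x"
    by (rule orbit_operator_eq[symmetric]) (use assms in auto)
  also have "(\<Sum>u\<in>?S. (d u * L2_inner M \<phi> (koopman T u f)) * koopman T u f x) = orbit_operator M T f d \<phi> x"
    by (rule orbit_operator_eq[symmetric]) (use assms in auto)
  finally show ?thesis .
qed

lemma orbit_kernel_sym: "orbit_kernel M T f u v = orbit_kernel M T f v u"
  unfolding orbit_kernel_def by (subst L2_inner_commute) simp

context z2_mps
begin

lemma orbit_kernel_shift:
  assumes "f \<in> L2_fun M"
  shows "orbit_kernel M T f (u + x) (v + x) = orbit_kernel M T f u v"
  using L2_inner_koopman[OF koopman_L2[OF assms, of u] koopman_L2[OF assms, of v], of x]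
  by (simp add: orbit_kernel_def koopman_koopman)

lemma orbit_kernel_nonneg:
  assumes "f \<in> L2_fun M"
  shows "0 \<le> kernel_form (orbit_kernel M T f) c c"
  unfolding kernel_form_def orbit_kernel_def
  by (rule Hilbert_Schmidt_nonneg) (intro koopman_L2 assms)

lemma orbit_operator_L2: "f \<in> L2_fun M \<Longrightarrow> orbit_operator M T f c \<phi> \<in> L2_fun M"
  unfolding orbit_operator_def[abs_def] by (intro L2_fun_sum L2_fun_scale koopman_L2)

lemma orbit_operator_norm_le:
  assumes "f \<in> L2_fun M" "\<phi> \<in> L2_fun M"
  shows "L2_norm M (orbit_operator M T f c \<phi>) \<le>
    sqrt (kernel_form (orbit_kernel M T f) c c) * L2_norm M \<phi>"
proof -
  have "(L2_norm M (orbit_operator M T f c \<phi>))\<^sup>2 \<le>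
      kernel_form (orbit_kernel M T f) c c * (L2_norm M \<phi>)\<^sup>2"
    unfolding orbit_operator_def[abs_def] kernel_form_def orbit_kernel_def
    by (rule Hilbert_Schmidt_bound) (intro koopman_L2 assms)+
  also have "\<dots> = (sqrt (kernel_form (orbit_kernel M T f) c c) * L2_norm M \<phi>)\<^sup>2"
    using orbit_kernel_nonneg[OF assms(1), of c] by (simp add: power_mult_distrib)
  finally show ?thesis
    by (rule power2_le_imp_le) (simp add: orbit_kernel_nonneg[OF assms(1)])
qed

text \<open>\<open>koopman T x\<close> preserves inner products and moves the orbit of
  \<open>f\<close> along itself, so conjugating the operator by it amounts to translating the
  weight.\<close>

lemma koopman_orbit_operator:
  assumes "f \<in> L2_fun M" "\<phi> \<in> L2_fun M"
  shows "koopman T x (orbit_operator M T f c \<phi>) =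
    orbit_operator M T f (\<lambda>u. c (u - x)) (koopman T x \<phi>)"
proof
  fix y
  have "orbit_operator M T f (\<lambda>u. c (u - x)) (koopman T x \<phi>) y =
     (\<Sum>u | c u \<noteq> 0. (c u * L2_inner M (koopman T x \<phi>) (koopman T (u + x) f)) * koopman T (u + x) f y)"
    by (simp add: orbit_operator_def shift_support sum.reindex)
  also have "\<dots> = koopman T x (orbit_operator M T f c \<phi>) y"
  proof -
    have "L2_inner M (koopman T x \<phi>) (koopman T (u + x) f) = L2_inner M \<phi> (koopman T u f)" for u
      using L2_inner_koopman[OF assms(2) koopman_L2[OF assms(1)], of x u] by (simp add: koopman_koopman)
    moreover have "koopman T (u + x) f y = koopman T u f (T x y)" for u
      by (simp only: koopman_koopman[symmetric] koopman_apply[of T x])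
    ultimately show ?thesis by (simp add: orbit_operator_def koopman_apply[of T x])
  qed
  finally show "koopman T x (orbit_operator M T f c \<phi>) y =
    orbit_operator M T f (\<lambda>u. c (u - x)) (koopman T x \<phi>) y" by simp
qed

text \<open>Each rank-one term contributes a squared modulus. This is the bridge by which norm
  bounds on operators become bounds on averages of coefficients.\<close>

lemma L2_inner_orbit_operator:
  assumes "f \<in> L2_fun M" "\<phi> \<in> L2_fun M"
  shows "L2_inner M (orbit_operator M T f c \<phi>) \<phi> =
    complex_of_real (\<Sum>u | c u \<noteq> 0. c u * (cmod (L2_inner M (koopman T u f) \<phi>))\<^sup>2)"
proof -
  have "L2_inner M (orbit_operator M T f c \<phi>) \<phi> =
      (\<Sum>u | c u \<noteq> 0. (c u * L2_inner M \<phi> (koopman T u f)) * L2_inner M (koopman T u f) \<phi>)"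
    unfolding orbit_operator_def[abs_def] by (intro L2_inner_sum_scale_left koopman_L2 assms)
  also have "\<dots> = (\<Sum>u | c u \<noteq> 0. complex_of_real (c u * (cmod (L2_inner M (koopman T u f) \<phi>))\<^sup>2))"
  proof (intro sum.cong refl)
    fix u
    show "(c u * L2_inner M \<phi> (koopman T u f)) * L2_inner M (koopman T u f) \<phi> =
        complex_of_real (c u * (cmod (L2_inner M (koopman T u f) \<phi>))\<^sup>2)"
      unfolding L2_inner_commute[of M \<phi> "koopman T u f"]
        of_real_mult complex_norm_square by (simp only: mult_ac)
  qed
  finally show ?thesis by simp
qed

text \<open>The limit is almost periodic because its \<open>v\<close>-translate is close to a shifted finite-rank
  operator applied to \<open>koopman T v \<phi>\<close>, where only finitely many shifts are needed.\<close>

lemma orbit_operator_limit: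
  assumes irr: "\<beta> \<notin> \<rat>" and f: "f \<in> L2_fun M" and \<phi>: "\<phi> \<in> L2_fun M"
    and w: "\<And>j. w j \<in> strip_weights \<beta> t"
    and cauchy: "\<And>e. e > 0 \<Longrightarrow> \<exists>N. \<forall>i\<ge>N. \<forall>j\<ge>N.
        kernel_form (orbit_kernel M T f) (\<lambda>u. w i u - w j u) (\<lambda>u. w i u - w j u) < e"
    and shift: "\<And>e. e > 0 \<Longrightarrow> \<exists>d>0. \<exists>N::nat. \<forall>j\<ge>N. \<forall>x\<in>strip \<beta> d.
        kernel_form (orbit_kernel M T f) (\<lambda>u. w j (u - x) - w j u) (\<lambda>u. w j (u - x) - w j u) < e"
  obtains h where "almost_periodic M T \<beta> c h"
    "(\<lambda>j. L2_norm M (\<lambda>x. orbit_operator M T f (w j) \<phi> x - h x)) \<longlonglongrightarrow> 0"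
proof -
  let ?K = "orbit_kernel M T f" and ?A = "orbit_operator M T f"
  define N where "N = L2_norm M \<phi>"
  have N: "0 \<le> N" by (simp add: N_def)
  have fin: "finite {u. w j u \<noteq> 0}" for j by (rule strip_weights_finite[OF w])
  have shfin: "finite {u. w j (u - x) \<noteq> 0}" for j x unfolding shift_support using fin by simp
  \<comment> \<open>Uniform over all \<open>\<psi>\<close> of norm \<open>N\<close>, hence
    applicable to all translates \<open>koopman T v \<phi>\<close> at once.\<close>
  have close: "L2_norm M (\<lambda>x. ?A c \<psi> x - ?A d \<psi> x) < e"
    if "finite {u. c u \<noteq> 0}" "finite {u. d u \<noteq> 0}" and \<psi>: "\<psi> \<in> L2_fun M" "L2_norm M \<psi> = N"
      and K: "kernel_form ?K (\<lambda>u. c u - d u) (\<lambda>u. c u - d u) < (e / (N + 1))\<^sup>2" and e: "e > 0" for c d \<psi> e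
  proof -
    let ?q = "sqrt (kernel_form ?K (\<lambda>u. c u - d u) (\<lambda>u. c u - d u))"
    have "?q < e / (N + 1)" using K e N by (intro real_less_lsqrt) (auto intro: orbit_kernel_nonneg f)
    have "L2_norm M (\<lambda>x. ?A c \<psi> x - ?A d \<psi> x) \<le> ?q * N"
    proof -
      have "?A (\<lambda>u. c u - d u) \<psi> = (\<lambda>x. ?A c \<psi> x - ?A d \<psi> x)"
        by (rule ext) (intro orbit_operator_diff that)
      then show ?thesis
        using orbit_operator_norm_le[OF f \<psi>(1), of "\<lambda>u. c u - d u"] \<psi>(2) by simp
    qed
    also have "\<dots> \<le> e / (N + 1) * N" using \<open>?q < _\<close> N by (intro mult_right_mono) auto
    also have "\<dots> < e" using N e by (simp add: field_simps)
    finally show ?thesis .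
  qed
  have "\<exists>n. \<forall>i\<ge>n. \<forall>j\<ge>n. L2_norm M (\<lambda>x. ?A (w i) \<phi> x - ?A (w j) \<phi> x) < e" if e: "e > 0" for e
  proof -
    have "(e / (N + 1))\<^sup>2 > 0" using e N by (simp add: add_nonneg_eq_0_iff)
    from cauchy[OF this] show ?thesis
      using close[OF fin fin \<phi> N_def[symmetric] _ e] by blast
  qed
  then obtain h where h: "h \<in> L2_fun M" and lim: "(\<lambda>j. L2_norm M (\<lambda>x. ?A (w j) \<phi> x - h x)) \<longlonglongrightarrow> 0"
    using L2_complete[of "\<lambda>j. ?A (w j) \<phi>"] orbit_operator_L2[OF f] by blast
  have "L2_totally_bounded M ((\<lambda>v. koopman T v h) ` strip \<beta> c)"
  proof (rule L2_totally_bounded_approx)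
    show "(\<lambda>v. koopman T v h) ` strip \<beta> c \<subseteq> L2_fun M" using h by (auto intro: koopman_L2)
    fix e :: real assume e: "e > 0"
    then have "(e / 2 / (N + 1))\<^sup>2 > 0" using N by (simp add: add_nonneg_eq_0_iff)
    from shift[OF this] obtain d n1 where d: "d > 0"
      "\<And>j x. j \<ge> n1 \<Longrightarrow> x \<in> strip \<beta> d \<Longrightarrow>
        kernel_form ?K (\<lambda>u. w j (u - x) - w j u) (\<lambda>u. w j (u - x) - w j u) < (e / 2 / (N + 1))\<^sup>2"
      by blast
    have "eventually (\<lambda>j. L2_norm M (\<lambda>x. ?A (w j) \<phi> x - h x) < e / 2) sequentially"
      using lim e by (intro order_tendstoD(2)) auto
    then obtain n2 where n2: "\<And>j. j \<ge> n2 \<Longrightarrow> L2_norm M (\<lambda>x. ?A (w j) \<phi> x - h x) < e / 2"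
      by (auto simp: eventually_sequentially)
    define j where "j = max n1 n2"
    obtain V where V: "finite V" "\<And>v. v \<in> strip \<beta> c \<Longrightarrow> \<exists>u\<in>V. v - u \<in> strip \<beta> d"
      using strip_finite_cover[OF irr d(1), of c] by metis
    \<comment> \<open>For fixed \<open>x\<close> and \<open>j\<close> all members lie in the span of
      finitely many orbit functions, with coefficients bounded by Cauchy-Schwarz; so
      \<open>G x\<close> is totally bounded although \<open>v\<close> ranges over an infinite
      strip.\<close>
    define G where "G x = (\<lambda>v. ?A (\<lambda>u. w j (u - x)) (koopman T v \<phi>)) ` strip \<beta> c" for x
    have "L2_totally_bounded M (G x)" for x
    proof (rule L2_totally_bounded_subset)
      let ?S = "{u. w j (u - x) \<noteq> 0}" and ?R = "N * L2_norm M f"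
      show "L2_totally_bounded M {\<lambda>y. \<Sum>u\<in>?S. a u * koopman T u f y | a. \<forall>u\<in>?S. cmod (a u) \<le> ?R}"
        by (intro L2_totally_bounded_span shfin koopman_L2 f)
      show "G x \<subseteq> {\<lambda>y. \<Sum>u\<in>?S. a u * koopman T u f y | a. \<forall>u\<in>?S. cmod (a u) \<le> ?R}"
      proof
        fix g assume "g \<in> G x"
        then obtain v where v: "g = ?A (\<lambda>u. w j (u - x)) (koopman T v \<phi>)" by (auto simp: G_def)
        let ?a = "\<lambda>u. w j (u - x) * L2_inner M (koopman T v \<phi>) (koopman T u f)"
        have "g = (\<lambda>y. \<Sum>u\<in>?S. ?a u * koopman T u f y)"
          by (simp add: v orbit_operator_def fun_eq_iff)
        moreover have "cmod (?a u) \<le> ?R" for u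
        proof -
          have "w j (u - x) \<le> 1"
          proof (cases "w j (u - x) = 0")
            case False
            then have "w j (u - x) \<le> (\<Sum>z | w j z \<noteq> 0. w j z)"
              by (intro member_le_sum) (auto intro: fin strip_weights_nonneg[OF w])
            then show ?thesis using w[of j] by (simp add: strip_weights_def)
          qed simp
          moreover have "cmod (L2_inner M (koopman T v \<phi>) (koopman T u f)) \<le> ?R"
            using L2_Cauchy_Schwarz[OF koopman_L2[OF \<phi>] koopman_L2[OF f], of v u]
            by (simp add: L2_norm_koopman \<phi> f N_def)
          ultimately have "\<bar>w j (u - x)\<bar> * cmod (L2_inner M (koopman T v \<phi>) (koopman T u f)) \<le> 1 * ?R"
            by (intro mult_mono) (auto simp: strip_weights_nonneg[OF w])
          then show ?thesis by (simp add: norm_mult)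
        qed
        ultimately show "g \<in> {\<lambda>y. \<Sum>u\<in>?S. a u * koopman T u f y | a. \<forall>u\<in>?S. cmod (a u) \<le> ?R}"
          by (intro CollectI exI[of _ ?a]) auto
      qed
    qed
    then have "L2_totally_bounded M (\<Union>x\<in>V. G x)"
      by (intro L2_totally_bounded_UN V(1))
    moreover have "(\<Union>x\<in>V. G x) \<subseteq> L2_fun M"
      by (auto simp: G_def intro: orbit_operator_L2 f)
    moreover have "\<exists>g\<in>(\<Union>x\<in>V. G x). L2_norm M (\<lambda>y. koopman T v h y - g y) \<le> e"
      if v: "v \<in> strip \<beta> c" for v
    proof -
      obtain x where x: "x \<in> V" "v - x \<in> strip \<beta> d" using V(2)[OF v] by blast
      let ?\<psi> = "koopman T v \<phi>"
      \<comment> \<open>\<open>?f\<close> is the exact translate of the approximant, with the weight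
        shifted by \<open>v\<close>; \<open>?g\<close> uses the nearby shift \<open>x\<close> from
        the finite set \<open>V\<close> instead.\<close>
      let ?g = "?A (\<lambda>u. w j (u - x)) ?\<psi>" and ?f = "?A (\<lambda>u. w j (u - v)) ?\<psi>"
      have L2: "koopman T v h \<in> L2_fun M" "?f \<in> L2_fun M" "?g \<in> L2_fun M"
        by (intro koopman_L2 h orbit_operator_L2 f)+
      have "L2_norm M (\<lambda>y. koopman T v h y - ?f y) =
          L2_norm M (koopman T v (\<lambda>y. h y - ?A (w j) \<phi> y))"
        unfolding koopman_pointwise koopman_orbit_operator[OF f \<phi>] ..
      also have "\<dots> = L2_norm M (\<lambda>y. ?A (w j) \<phi> y - h y)"
        by (subst L2_norm_koopman) (auto intro: L2_fun_diff h orbit_operator_L2 f L2_norm_minus_commute)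
      also have "\<dots> < e / 2" by (rule n2) (simp add: j_def)
      finally have 1: "L2_norm M (\<lambda>y. koopman T v h y - ?f y) < e / 2" .
      \<comment> \<open>Translating back by \<open>x\<close> leaves a single shift by
        \<open>v - x\<close>, which lies in the thin strip.\<close>
      have "kernel_form ?K (\<lambda>u. w j (u - v) - w j (u - x)) (\<lambda>u. w j (u - v) - w j (u - x)) =
          kernel_form ?K (\<lambda>u. w j (u - (v - x)) - w j u) (\<lambda>u. w j (u - (v - x)) - w j u)"
        using kernel_form_shift[of ?K "\<lambda>u. w j (u - (v - x)) - w j u" x "\<lambda>u. w j (u - (v - x)) - w j u",
          OF orbit_kernel_shift[OF f]] by simp
      also have "\<dots> < (e / 2 / (N + 1))\<^sup>2" by (rule d(2)) (use x in \<open>auto simp: j_def\<close>)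
      finally have 2: "L2_norm M (\<lambda>y. ?f y - ?g y) < e / 2"
        using e by (intro close shfin koopman_L2 \<phi>) (simp_all add: L2_norm_koopman \<phi> N_def)
      have "L2_norm M (\<lambda>y. koopman T v h y - ?g y) \<le> e"
        using L2_norm_diff_triangle[OF L2] 1 2 by linarith
      with x(1) v show ?thesis by (intro bexI[of _ ?g]) (auto simp: G_def)
    qed
    ultimately show "\<exists>G\<subseteq>L2_fun M. L2_totally_bounded M G \<and>
        (\<forall>f\<in>(\<lambda>v. koopman T v h) ` strip \<beta> c. \<exists>g\<in>G. L2_norm M (\<lambda>x. f x - g x) \<le> e)"
      by blast
  qed
  then have "almost_periodic M T \<beta> c h" using h by (simp add: almost_periodic_def)
  with lim show ?thesis using that by blast
qed

text \<open>The limit \<open>h\<close> of the operators applied to \<open>koopman T v f\<close> is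
  orthogonal to \<open>koopman T v f\<close>, so the mixed form of \<open>w i\<close> and
  \<open>w j\<close> tends to 0 as \<open>j\<close> grows with \<open>i\<close> fixed. For a Cauchy
  sequence this forces the forms themselves to become small.\<close>

lemma WM_small_weights:
  assumes irr: "\<beta> \<notin> \<rat>" and f: "f \<in> WM M T \<beta> c"
  obtains t where "t > 0"
    "\<And>e. e > 0 \<Longrightarrow> \<exists>w\<in>strip_weights \<beta> t. kernel_form (orbit_kernel M T f) w w < e"
proof -
  let ?K = "orbit_kernel M T f" and ?A = "orbit_operator M T f"
  have fL2: "f \<in> L2_fun M" using f by (simp add: WM_def)
  obtain t w where t: "t > 0" and w: "\<And>j::nat. w j \<in> strip_weights \<beta> t"
    and cauchy: "\<And>e. e > 0 \<Longrightarrow> \<exists>N. \<forall>i\<ge>N. \<forall>j\<ge>N. kernel_form ?K (\<lambda>u. w i u - w j u) (\<lambda>u. w i u - w j u) < e"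
    and shift: "\<And>e. e > 0 \<Longrightarrow> \<exists>d>0. \<exists>N. \<forall>j\<ge>N. \<forall>x\<in>strip \<beta> d.
        kernel_form ?K (\<lambda>u. w j (u - x) - w j u) (\<lambda>u. w j (u - x) - w j u) < e"
    by (rule minimizing_strip_weights[of ?K \<beta>, OF orbit_kernel_shift[OF fL2] orbit_kernel_nonneg[OF fL2]]) blast
  have fin: "finite {u. w j u \<noteq> 0}" for j by (rule strip_weights_finite[OF w])
  have vanish: "(\<lambda>j. \<Sum>u | w j u \<noteq> 0. w j u * ?K u v) \<longlonglongrightarrow> 0" for v
  proof -
    let ?\<phi> = "koopman T v f"
    have \<phi>: "?\<phi> \<in> L2_fun M" by (rule koopman_L2[OF fL2])
    obtain h where h: "almost_periodic M T \<beta> c h"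
      and lim: "(\<lambda>j. L2_norm M (\<lambda>x. ?A (w j) ?\<phi> x - h x)) \<longlonglongrightarrow> 0"
      by (rule orbit_operator_limit[OF irr fL2 \<phi> w cauchy shift, of c])
    have hL2: "h \<in> L2_fun M" using h by (simp add: almost_periodic_def)
    \<comment> \<open>The translation is moved from \<open>f\<close> to \<open>h\<close>, which
      stays almost periodic.\<close>
    have "L2_inner M ?\<phi> h = 0"
      using WM_orthogonal[OF f almost_periodic_koopman[OF h, of "- v"]]
      by (simp add: L2_inner_koopman_left[OF fL2 hL2])
    then have hz: "L2_inner M h ?\<phi> = 0" by (subst L2_inner_commute) simp
    have AL2: "?A (w j) ?\<phi> \<in> L2_fun M" for j by (rule orbit_operator_L2[OF fL2])
    have bound: "\<bar>\<Sum>u | w j u \<noteq> 0. w j u * ?K u v\<bar> \<le>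
        L2_norm M (\<lambda>x. ?A (w j) ?\<phi> x - h x) * L2_norm M ?\<phi>" for j
    proof -
      have "L2_inner M (\<lambda>x. ?A (w j) ?\<phi> x - h x) ?\<phi> =
          complex_of_real (\<Sum>u | w j u \<noteq> 0. w j u * ?K u v)"
        using L2_inner_diff_left[OF AL2 hL2 \<phi>, of j] L2_inner_orbit_operator[OF fL2 \<phi>, of "w j"] hz
        by (simp add: orbit_kernel_def)
      then show ?thesis
        using L2_Cauchy_Schwarz[OF L2_fun_diff[OF AL2 hL2] \<phi>, of j] by (simp only: norm_of_real)
    qed
    have "(\<lambda>j. L2_norm M (\<lambda>x. ?A (w j) ?\<phi> x - h x) * L2_norm M ?\<phi>) \<longlonglongrightarrow> 0"
      using lim by (rule tendsto_mult_left_zero)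
    then show ?thesis
      by (rule Lim_null_comparison[rotated]) (simp add: bound)
  qed
  have cross: "(\<lambda>j. kernel_form ?K (w i) (w j)) \<longlonglongrightarrow> 0" for i
  proof -
    have "kernel_form ?K (w i) (w j) = (\<Sum>v | w i v \<noteq> 0. w i v * (\<Sum>u | w j u \<noteq> 0. w j u * ?K u v))" for j
      unfolding kernel_form_def
      unfolding sum_distrib_left
    proof (intro sum.cong refl)
      fix v u
      show "w i v * w j u * ?K v u = w i v * (w j u * ?K u v)"
        by (subst orbit_kernel_sym) (rule mult.assoc)
    qed
    moreover have "(\<lambda>j. \<Sum>v | w i v \<noteq> 0. w i v * (\<Sum>u | w j u \<noteq> 0. w j u * ?K u v)) \<longlonglongrightarrow> (\<Sum>v | w i v \<noteq> 0. w i v * 0)"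
      by (intro tendsto_sum tendsto_mult tendsto_const vanish)
    ultimately show ?thesis by simp
  qed
  show ?thesis
  proof (rule that[OF t])
    fix e :: real assume e: "e > 0"
    from cauchy[OF half_gt_zero[OF e]] obtain N where N: "\<And>i j. i \<ge> N \<Longrightarrow> j \<ge> N \<Longrightarrow>
        kernel_form ?K (\<lambda>u. w i u - w j u) (\<lambda>u. w i u - w j u) < e / 2"
      by blast
    have "eventually (\<lambda>j. kernel_form ?K (w N) (w j) < e / 4) sequentially"
      using cross[of N] e by (intro order_tendstoD(2)) auto
    then have "eventually (\<lambda>j. kernel_form ?K (w N) (w j) < e / 4 \<and> j \<ge> N) sequentially"
      by (intro eventually_conj eventually_ge_at_top)
    then obtain j where j: "kernel_form ?K (w N) (w j) < e / 4" "j \<ge> N"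
      using eventually_happens'[OF sequentially_bot] by blast
    \<comment> \<open>Expanding the form of \<open>w N - w j\<close> and dropping the nonnegative
      form of \<open>w j\<close> gives less than \<open>e/2 + 2 * (e/4)\<close>.\<close>
    have "kernel_form ?K (w N) (w N) < e"
      using kernel_form_diff[of "w N" "w j" ?K, OF fin fin orbit_kernel_sym] N[of N j] j
        orbit_kernel_nonneg[OF fL2, of "w j"] by linarith
    then show "\<exists>w\<in>strip_weights \<beta> t. kernel_form ?K w w < e" using w by blast
  qed
qed

subsection \<open>Averages along the strip\<close>

text \<open>The bound is uniform in \<open>z\<close> because translating a weight does not change
  its Hilbert-Schmidt norm; so a single weight controls the whole strip.\<close>

lemma weighted_coefficients_le:
  assumes f: "f \<in> L2_fun M" and g: "g \<in> L2_fun M"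
  shows "(\<Sum>u | w u \<noteq> 0. w u * (cmod (L2_inner M (koopman T (u + z) f) g))\<^sup>2) \<le>
    sqrt (kernel_form (orbit_kernel M T f) w w) * (L2_norm M g)\<^sup>2"
proof -
  let ?c = "\<lambda>u. w (u - z)"
  let ?s = "\<Sum>u | w u \<noteq> 0. w u * (cmod (L2_inner M (koopman T (u + z) f) g))\<^sup>2"
  have "(\<Sum>u | ?c u \<noteq> 0. ?c u * (cmod (L2_inner M (koopman T u f) g))\<^sup>2) = ?s"
    unfolding shift_support by (subst sum.reindex) (auto intro: inj_onI)
  then have "L2_inner M (orbit_operator M T f ?c g) g = complex_of_real ?s"
    by (simp only: L2_inner_orbit_operator[OF f g])
  then have "?s \<le> cmod (L2_inner M (orbit_operator M T f ?c g) g)"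
    by (simp only: norm_of_real abs_ge_self)
  also have "\<dots> \<le> L2_norm M (orbit_operator M T f ?c g) * L2_norm M g"
    by (rule L2_Cauchy_Schwarz[OF orbit_operator_L2[OF f] g])
  also have "\<dots> \<le> (sqrt (kernel_form (orbit_kernel M T f) ?c ?c) * L2_norm M g) * L2_norm M g"
    by (intro mult_right_mono orbit_operator_norm_le f g) simp
  also have "kernel_form (orbit_kernel M T f) ?c ?c = kernel_form (orbit_kernel M T f) w w"
    by (rule kernel_form_shift) (rule orbit_kernel_shift[OF f])
  finally show ?thesis by (simp add: power2_eq_square mult.assoc)
qed

text \<open>Every point of \<open>strip_upto \<beta> b k\<close> is a translate \<open>z + u\<close> of each \<open>u\<close> in the support of the
  weight by some \<open>z\<close> in a slightly larger window, so the sum over the window of the weighted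
  averages dominates the sum over the strip.\<close>

lemma strip_sum_le:
  fixes a :: "int \<times> int \<Rightarrow> real"
  assumes w: "w \<in> strip_weights \<beta> t" and t: "t > 0" and b: "b > 0"
    and a: "\<And>v. 0 \<le> a v" and B: "\<And>z. (\<Sum>u | w u \<noteq> 0. w u * a (u + z)) \<le> B"
  shows "\<forall>\<^sub>F k in sequentially. (\<Sum>v\<in>strip_upto \<beta> b k. a v) \<le> 2 * (2 * (b + t) + 1) * B * real k"
proof -
  let ?S = "{u. w u \<noteq> 0}"
  have fin: "finite ?S" by (rule strip_weights_finite[OF w])
  define P where "P = Max (insert 0 ((\<lambda>v. \<bar>fst v\<bar>) ` ?S))"
  have P: "\<bar>fst u\<bar> \<le> P" if "w u \<noteq> 0" for u
    unfolding P_def using fin that by (intro Max_ge) auto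
  have P0: "0 \<le> P" unfolding P_def using fin by (intro Max_ge) auto
  have "0 \<le> (\<Sum>u\<in>?S. w u * a (u + 0))"
    using a strip_weights_nonneg[OF w] by (intro sum_nonneg mult_nonneg_nonneg) auto
  then have B0: "0 \<le> B" using B[of 0] by linarith
  have "(\<Sum>v\<in>strip_upto \<beta> b k. a v) \<le> 2 * (2 * (b + t) + 1) * B * real k"
    if k: "k \<ge> nat (2 * P + 1)" for k
  proof -
    define Z where "Z = strip \<beta> (b + t) \<inter> ({- P..int k + P} \<times> UNIV)"
    have finZ: "finite Z" unfolding Z_def by (rule finite_strip_window)
    have inner: "(\<Sum>v\<in>strip_upto \<beta> b k. a v) \<le> (\<Sum>z\<in>Z. a (u + z))" if u: "w u \<noteq> 0" for u
    proof -
      have sub: "(\<lambda>v. v - u) ` strip_upto \<beta> b k \<subseteq> Z"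
      proof (rule image_subsetI)
        fix v assume v: "v \<in> strip_upto \<beta> b k"
        have "u \<in> strip \<beta> t" using w u by (auto simp: strip_weights_def)
        then have "v - u \<in> strip \<beta> (b + t)" using v by (auto simp: strip_upto_def intro: strip_diff)
        moreover have "fst (v - u) \<in> {- P..int k + P}"
          using v P[OF u] by (auto simp: strip_upto_def)
        ultimately show "v - u \<in> Z" by (simp add: Z_def mem_Times_iff)
      qed
      have "(\<Sum>v\<in>strip_upto \<beta> b k. a v) = (\<Sum>z\<in>(\<lambda>v. v - u) ` strip_upto \<beta> b k. a (u + z))"
        by (subst sum.reindex) (auto simp: inj_on_def)
      also have "\<dots> \<le> (\<Sum>z\<in>Z. a (u + z))"
        by (rule sum_mono2[OF finZ sub]) (rule a)
      finally show ?thesis .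
    qed
    have "(\<Sum>v\<in>strip_upto \<beta> b k. a v) = (\<Sum>u\<in>?S. w u) * (\<Sum>v\<in>strip_upto \<beta> b k. a v)"
      using w by (simp add: strip_weights_def)
    also have "\<dots> \<le> (\<Sum>u\<in>?S. w u * (\<Sum>z\<in>Z. a (u + z)))"
      unfolding sum_distrib_right
      by (intro sum_mono mult_left_mono inner strip_weights_nonneg[OF w]) auto
    also have "\<dots> = (\<Sum>z\<in>Z. \<Sum>u\<in>?S. w u * a (u + z))"
      unfolding sum_distrib_left by (rule sum.swap)
    also have "\<dots> \<le> (\<Sum>z\<in>Z. B)" by (intro sum_mono B)
    also have "\<dots> = real (card Z) * B" by simp
    also have "\<dots> \<le> (real (nat (int k + P - - P + 1)) * (2 * (b + t) + 1)) * B"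
      unfolding Z_def using t b B0 by (intro mult_right_mono card_strip_window_le) auto
    also have "\<dots> \<le> (2 * real k * (2 * (b + t) + 1)) * B"
    proof (intro mult_right_mono B0)
      \<comment> \<open>\<open>k \<ge> 2 * P + 1\<close> bounds the number of columns of the
        enlarged window by \<open>2 * k\<close>.\<close>
      have "nat (int k + P - - P + 1) \<le> 2 * k" using k P0 by linarith
      then show "real (nat (int k + P - - P + 1)) \<le> 2 * real k"
        using of_nat_mono by fastforce
    qed (use t b in auto)
    finally show ?thesis by (simp add: mult_ac)
  qed
  then show ?thesis by (auto simp: eventually_sequentially)
qed

lemma card_strip_upto_pos:
  assumes "b > 0" "k > 0"
  shows "card (strip_upto \<beta> b k) > 0"
proof -
  have "0 \<in> strip_upto \<beta> b k"
    using assms zero_in_strip[of b \<beta>] by (auto simp: strip_upto_def zero_prod_def)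
  then show ?thesis using finite_strip_upto[of \<beta> b k] by (auto simp: card_gt_0_iff)
qed

text \<open>The operators control squared coefficients, so those are averaged first; Cauchy-Schwarz
  for finite sums then passes to moduli. The positive density of the strip turns a bound in terms of
  \<open>k\<close> into one in terms of the number of points.\<close>

lemma WM_imp_averages_vanish:
  assumes irr: "\<beta> \<notin> \<rat>" and b: "b > 0" and f: "f \<in> WM M T \<beta> c" and g: "g \<in> L2_fun M"
  shows "(\<lambda>k. 1 / real (card (strip_upto \<beta> b k)) *
     (\<Sum>v\<in>strip_upto \<beta> b k. cmod (L2_inner M (koopman T v f) g))) \<longlonglongrightarrow> 0"
proof -
  define s where "s v = cmod (L2_inner M (koopman T v f) g)" for v
  define n where "n k = real (card (strip_upto \<beta> b k))" for k
  have fL2: "f \<in> L2_fun M" using f by (simp add: WM_def)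
  obtain t where t: "t > 0"
    and small: "\<And>e. e > 0 \<Longrightarrow> \<exists>w\<in>strip_weights \<beta> t. kernel_form (orbit_kernel M T f) w w < e"
    using WM_small_weights[OF irr f] by blast
  obtain C where C: "C > 0" "\<forall>\<^sub>F k in sequentially. real k \<le> C * n k"
    unfolding n_def using card_strip_upto_ge[OF irr b] by metis
  define E where "E = 2 * (2 * (b + t) + 1) * C"
  have E: "E > 0" using b t C by (simp add: E_def)
  have sq: "(\<lambda>k. (\<Sum>v\<in>strip_upto \<beta> b k. (s v)\<^sup>2) / n k) \<longlonglongrightarrow> 0"
  proof (rule tendstoI)
    fix e :: real assume e: "e > 0"
    define G where "G = (L2_norm M g)\<^sup>2 + 1"
    have G: "G > 0" by (simp add: G_def add_nonneg_pos)
    \<comment> \<open>\<open>E\<close> collects the constants of \<open>strip_sum_le\<close> and of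
      the density bound, and \<open>G\<close> is a positive bound for the squared norm of
      \<open>g\<close>; this choice gives \<open>E * q * G = e / 2\<close>.\<close>
    define q where "q = e / (2 * E * G)"
    have q: "q > 0" using e E G by (simp add: q_def)
    then obtain w where w: "w \<in> strip_weights \<beta> t" "kernel_form (orbit_kernel M T f) w w < q\<^sup>2"
      using small[of "q\<^sup>2"] by auto
    have "sqrt (kernel_form (orbit_kernel M T f) w w) \<le> q"
      using w(2) q by (intro real_le_lsqrt) (auto intro: orbit_kernel_nonneg fL2)
    then have "sqrt (kernel_form (orbit_kernel M T f) w w) * (L2_norm M g)\<^sup>2 \<le> q * G"
      using q by (intro mult_mono) (auto simp: G_def)
    then have B: "(\<Sum>u | w u \<noteq> 0. w u * (s (u + z))\<^sup>2) \<le> q * G" for z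
      unfolding s_def using weighted_coefficients_le[OF fL2 g, of w z] by linarith
    have "\<forall>\<^sub>F k in sequentially. (\<Sum>v\<in>strip_upto \<beta> b k. (s v)\<^sup>2) \<le> 2 * (2 * (b + t) + 1) * (q * G) * real k"
      by (rule strip_sum_le[OF w(1) t b _ B]) simp
    then show "\<forall>\<^sub>F k in sequentially. dist ((\<Sum>v\<in>strip_upto \<beta> b k. (s v)\<^sup>2) / n k) 0 < e"
      using C(2) eventually_gt_at_top[of 0]
    proof eventually_elim
      case (elim k)
      have n: "n k > 0" using card_strip_upto_pos[OF b elim(3)] by (simp add: n_def)
      have "(\<Sum>v\<in>strip_upto \<beta> b k. (s v)\<^sup>2) \<le> 2 * (2 * (b + t) + 1) * (q * G) * (C * n k)"
        using elim(1,2) b t q G by (elim order_trans) (intro mult_left_mono, auto)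
      also have "\<dots> = e / 2 * n k" using E G by (simp add: q_def E_def[symmetric] mult_ac) (simp add: E_def field_simps)
      also have "\<dots> < e * n k" using e n by simp
      finally have "(\<Sum>v\<in>strip_upto \<beta> b k. (s v)\<^sup>2) / n k < e" using n by (simp add: field_simps)
      moreover have "0 \<le> (\<Sum>v\<in>strip_upto \<beta> b k. (s v)\<^sup>2) / n k" using n by (intro divide_nonneg_pos sum_nonneg) auto
      ultimately show ?case by (simp add: dist_real_def)
    qed
  qed
  have "(\<lambda>k. 1 / n k * (\<Sum>v\<in>strip_upto \<beta> b k. s v)) \<longlonglongrightarrow> 0"
  proof (rule Lim_null_comparison)
    show "(\<lambda>k. sqrt ((\<Sum>v\<in>strip_upto \<beta> b k. (s v)\<^sup>2) / n k)) \<longlonglongrightarrow> 0"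
      using tendsto_real_sqrt[OF sq] by simp
    show "\<forall>\<^sub>F k in sequentially. norm (1 / n k * (\<Sum>v\<in>strip_upto \<beta> b k. s v)) \<le>
        sqrt ((\<Sum>v\<in>strip_upto \<beta> b k. (s v)\<^sup>2) / n k)"
      using eventually_gt_at_top[of 0]
    proof eventually_elim
      case (elim k)
      have n: "n k > 0" using card_strip_upto_pos[OF b elim] by (simp add: n_def)
      have "(\<Sum>v\<in>strip_upto \<beta> b k. s v)\<^sup>2 \<le> (\<Sum>v\<in>strip_upto \<beta> b k. (s v)\<^sup>2) * n k"
        unfolding n_def by (rule sum_squared_le_sum_of_squares)
      then have "(1 / n k * (\<Sum>v\<in>strip_upto \<beta> b k. s v))\<^sup>2 \<le> (\<Sum>v\<in>strip_upto \<beta> b k. (s v)\<^sup>2) / n k"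
        using n by (simp add: power_mult_distrib power_divide field_simps power2_eq_square)
      then have "\<bar>1 / n k * (\<Sum>v\<in>strip_upto \<beta> b k. s v)\<bar> \<le> sqrt ((\<Sum>v\<in>strip_upto \<beta> b k. (s v)\<^sup>2) / n k)"
        by (metis real_sqrt_abs real_sqrt_le_iff)
      then show ?case by simp
    qed
  qed
  then show ?thesis by (simp add: s_def n_def)
qed

lemma averages_vanish_orthogonal:
  assumes f: "f \<in> L2_fun M" and b: "b > 0" and h: "almost_periodic M T \<beta> b h"
    and avg: "\<And>g. g \<in> L2_fun M \<Longrightarrow> (\<lambda>k. 1 / real (card (strip_upto \<beta> b k)) *
       (\<Sum>v\<in>strip_upto \<beta> b k. cmod (L2_inner M (koopman T v f) g))) \<longlonglongrightarrow> 0"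
  shows "L2_inner M f h = 0"
proof -
  have hL2: "h \<in> L2_fun M" using h by (simp add: almost_periodic_def)
  define N where "N = L2_norm M f"
  have N: "0 \<le> N" by (simp add: N_def)
  have "cmod (L2_inner M f h) \<le> 0 + e" if e: "e > 0" for e
  proof -
    have tb: "L2_totally_bounded M ((\<lambda>v. koopman T v h) ` strip \<beta> b)"
      using h by (simp add: almost_periodic_def)
    have "e / (N + 1) > 0" using e N by simp
    then obtain S where S: "finite S" "S \<subseteq> L2_fun M"
      "\<And>g. g \<in> (\<lambda>v. koopman T v h) ` strip \<beta> b \<Longrightarrow> \<exists>s\<in>S. L2_norm M (\<lambda>x. g x - s x) < e / (N + 1)"
      using L2_totally_boundedE[OF tb] by metis
    define A where "A k g = 1 / real (card (strip_upto \<beta> b k)) *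
       (\<Sum>v\<in>strip_upto \<beta> b k. cmod (L2_inner M (koopman T v f) g))" for k g
    \<comment> \<open>Translating both functions leaves the inner product unchanged, so the left
      side does not depend on \<open>v\<close>. Averaging over the strip keeps it, while the
      averaged right side tends to \<open>e\<close>.\<close>
    have pt: "cmod (L2_inner M f h) \<le> (\<Sum>s\<in>S. cmod (L2_inner M (koopman T v f) s)) + e"
      if v: "v \<in> strip \<beta> b" for v
    proof -
      obtain s where s: "s \<in> S" "L2_norm M (\<lambda>x. koopman T v h x - s x) < e / (N + 1)"
        using S(3) v by blast
      have sL2: "s \<in> L2_fun M" using s S by auto
      let ?f = "koopman T v f" and ?h = "koopman T v h"
      have L2: "?f \<in> L2_fun M" "?h \<in> L2_fun M" using f hL2 by (simp_all add: koopman_L2)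
      have "L2_inner M (\<lambda>x. ?h x - s x) ?f = L2_inner M ?h ?f - L2_inner M s ?f"
        by (rule L2_inner_diff_left[OF L2(2) sL2 L2(1)])
      then have "cmod (L2_inner M ?h ?f) \<le> cmod (L2_inner M s ?f) + cmod (L2_inner M (\<lambda>x. ?h x - s x) ?f)"
        by (metis diff_add_cancel add.commute norm_triangle_ineq)
      also have "cmod (L2_inner M (\<lambda>x. ?h x - s x) ?f) \<le> L2_norm M (\<lambda>x. ?h x - s x) * N"
        using L2_Cauchy_Schwarz[OF L2_fun_diff[OF L2(2) sL2] L2(1)] by (simp add: L2_norm_koopman f N_def)
      also have "\<dots> \<le> e / (N + 1) * N" using s N by (intro mult_right_mono) auto
      also have "\<dots> \<le> e" using N e by (simp add: field_simps)
      also have "cmod (L2_inner M s ?f) = cmod (L2_inner M ?f s)" by (subst L2_inner_commute) simp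
      also have "\<dots> \<le> (\<Sum>s\<in>S. cmod (L2_inner M ?f s))"
        using S(1) s(1) by (intro member_le_sum) auto
      also have "cmod (L2_inner M ?h ?f) = cmod (L2_inner M f h)"
        by (subst L2_inner_commute) (simp add: L2_inner_koopman f hL2)
      finally show ?thesis by simp
    qed
    have "cmod (L2_inner M f h) \<le> (\<Sum>s\<in>S. A k s) + e" if k: "k > 0" for k
    proof -
      define n where "n = real (card (strip_upto \<beta> b k))"
      have n: "n > 0" using card_strip_upto_pos[OF b k] by (simp add: n_def)
      have "n * cmod (L2_inner M f h) = (\<Sum>v\<in>strip_upto \<beta> b k. cmod (L2_inner M f h))"
        by (simp add: n_def)
      also have "\<dots> \<le> (\<Sum>v\<in>strip_upto \<beta> b k. (\<Sum>s\<in>S. cmod (L2_inner M (koopman T v f) s)) + e)"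
        by (intro sum_mono pt) (simp add: strip_upto_def)
      also have "\<dots> = n * ((\<Sum>s\<in>S. A k s) + e)"
        proof -
        have "n * A k s = (\<Sum>v\<in>strip_upto \<beta> b k. cmod (L2_inner M (koopman T v f) s))" for s
          using n by (simp add: A_def flip: n_def)
        then have "n * (\<Sum>s\<in>S. A k s) =
            (\<Sum>v\<in>strip_upto \<beta> b k. \<Sum>s\<in>S. cmod (L2_inner M (koopman T v f) s))"
          by (simp add: sum_distrib_left sum.swap[of _ S])
        then show ?thesis by (simp add: sum.distrib distrib_left n_def)
      qed
      finally show ?thesis using n by simp
    qed
    then have "\<forall>\<^sub>F k in sequentially. cmod (L2_inner M f h) \<le> (\<Sum>s\<in>S. A k s) + e"
      using eventually_gt_at_top[of 0] by (rule eventually_mono[rotated])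
    moreover have "(\<lambda>k. (\<Sum>s\<in>S. A k s) + e) \<longlonglongrightarrow> (\<Sum>s\<in>S. 0) + e"
      unfolding A_def using S(2) by (intro tendsto_intros avg) auto
    ultimately show ?thesis
      by (intro tendsto_lowerbound[of "\<lambda>k. (\<Sum>s\<in>S. A k s) + e"]) auto
  qed
  then have "cmod (L2_inner M f h) \<le> 0" by (rule field_le_epsilon)
  then show ?thesis by simp
qed

end

text \<open>The width \<open>c\<close> of the algebra and the width \<open>b\<close> of the averages
  are independent, so the statement also contains the fact that \<open>WM M T \<beta> c\<close> is
  the same for all \<open>c > 0\<close>.\<close>

theorem theorem3p12:
  fixes M :: "'a::metric_space measure"
    and T :: "int \<times> int \<Rightarrow> 'a \<Rightarrow> 'a"
    and \<beta> b c :: real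
  assumes "z2_mps M T"
    and "\<beta> \<notin> \<rat>"
    and "b > 0"
    and "c > 0"
  shows "WM M T \<beta> c =
    {f \<in> L2_fun M. \<forall>g \<in> L2_fun M.
       (\<lambda>k. 1 / real (card (strip_upto \<beta> b k)) *
             (\<Sum>v\<in>strip_upto \<beta> b k. cmod (L2_inner M (koopman T v f) g))) \<longlonglongrightarrow> 0}"
    (is "_ = ?R")
proof -
  interpret z2_mps M T by fact
  show ?thesis
  proof (intro equalityI subsetI)
    fix f assume f: "f \<in> WM M T \<beta> c"
    then show "f \<in> ?R"
      using WM_imp_averages_vanish[OF assms(2,3) f] by (simp add: WM_def)
  next
    fix f assume f: "f \<in> ?R"
    show "f \<in> WM M T \<beta> c"
    proof (rule WM_I)
      fix B assume "B \<in> kronecker_sets M T \<beta> c"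
      \<comment> \<open>Total boundedness is moved from the width \<open>c\<close> of the algebra to
        the width \<open>b\<close> over which the averages run.\<close>
      then have "almost_periodic M T \<beta> b (indicator B)"
        using almost_periodic_width[OF assms(2,4)] by (simp add: kronecker_sets_iff)
      then show "L2_inner M f (indicator B) = 0"
        using averages_vanish_orthogonal[of f b \<beta>] f assms(3) by simp
    qed (use f in simp)
  qed
qed

end
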